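(* $W[X_3]$ is not biconnected.
   Context: $C$ is the middle-thirds Cantor set in $[0,1]$ and $\omega=\{0,1,2,\dots\}$. A connected space is *biconnected* if it is not the union of two disjoint connected sets each containing more than one point. The space $W[X_3]$ is connected. Definition of $X_3$. The non-endpoints of $C$ are the points of $C$ other than $0$, $1$ and the endpoints of the open intervals removed from $[0,1]$ in constructing $C$. Fix a countable set $D=\{d_n:n<\omega\}$ of non-endpoints of $C$ (enumerated without repetition) that is dense in $C$, and a sequence $(a_n)_{n<\omega}$ of positive real numbers with $\sum_{n=0}^\infty a_n=1$. Define $f:C\to[0,1]$ by $f(c)=\sum_{\{n<\omega:\,d_n<c\}}a_n$. Let $\mathbb Q=\{q_n:n<\omega\}$ be an enumeration of the rationals. Write $\mathrm{Gr}(f+q_n)=\{\langle c,f(c)+q_n\rangle:c\in C\}$, and let the overline denote closure in $C\times\mathbb R$. Put $$Y=(C\times\mathbb R)\setminus\bigcup_{n<\omega}\overline{\mathrm{Gr}(f+q_n)},\qquad \Xi:C\times\mathbb R\to C\times(0,1),\ \ \Xi(\langle c,r\rangle)=\Big\langle c,\tfrac{\arctan(r)}{\pi}+\tfrac12\Big\rangle,\qquad X_3=\Xi[Y].$$ Definition of $W[X]$. $K\subseteq[0,1]^2$ is the (rectilinear) Knaster bucket-handle continuum, $\Delta=\{\langle x,x\rangle\in K:x\in[0,1]\}$ is its diagonal Cantor set, and $K\setminus\Delta=\bigcup_{i<\omega}K_i$ is the disjoint union of open copies $K_i$ of $C\times(0,1)$, with homeomorphisms $\varphi_i:C\times(0,1)\to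 K_i$. Explicitly, $\Delta=\{\langle x,x\rangle:x\in C\}$, and the maps are as follows. - For $i=0$ and $c\in C$, put $x=c/3$ and $y=1-x$. Then $\varphi_0(c,t)=\langle x,\,x+2t(y-x)\rangle$ for $0<t\le 1/2$, and $\varphi_0(c,t)=\langle x+(2t-1)(y-x),\,y\rangle$ for $1/2\le t<1$. - For $i\ge1$ and $c\in C$, put $x=2/3^i+c/3^{i+1}$ and $y=5/3^i-x$. Then $\varphi_i(c,t)=\langle x+2t(y-x),\,x\rangle$ for $0<t\le1/2$, and $\varphi_i(c,t)=\langle y,\,x+(2t-1)(y-x)\rangle$ for $1/2\le t<1$. Put $K_i=\varphi_i[C\times(0,1)]$ and $K=\Delta\cup\bigcup_{i<\omega}K_i$. For $X\subseteq C\times(0,1)$ define $W[X]=\Delta\cup\bigcup_{i<\omega}\varphi_i[X]$, with the subspace topology from $K\subseteq\mathbb R^2$. *)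

theory Defs
  imports "HOL-Analysis.Analysis"
begin

text \<open>Closed intervals are represented by their pairs of endpoints.\<close>

primrec cantor_intervals :: "nat \<Rightarrow> (real \<times> real) set" where
  "cantor_intervals 0 = {(0, 1)}"
| "cantor_intervals (Suc n) =
     (\<Union>(u, v)\<in>cantor_intervals n. {(u, (2 * u + v) / 3), ((u + 2 * v) / 3, v)})"

definition cantor_gaps :: "(real \<times> real) set" where
  "cantor_gaps = (\<Union>n. (\<lambda>(u, v). ((2 * u + v) / 3, (u + 2 * v) / 3)) ` cantor_intervals n)"

definition cantor_set :: "real set" where
  "cantor_set = {0..1} - (\<Union>(u, v)\<in>cantor_gaps. {u<..<v})"

definition cantor_nonendpoints :: "real set" where
  "cantor_nonendpoints = cantor_set - ({0, 1} \<union> (\<Union>(u, v)\<in>cantor_gaps. {u, v}))"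

definition jump_fun :: "(nat \<Rightarrow> real) \<Rightarrow> (nat \<Rightarrow> real) \<Rightarrow> real \<Rightarrow> real" where
  "jump_fun d a c = (\<Sum>\<^sub>\<infinity>n\<in>{n. d n < c}. a n)"

definition cantor_graph :: "(real \<Rightarrow> real) \<Rightarrow> (real \<times> real) set" where
  "cantor_graph g = (\<lambda>c. (c, g c)) ` cantor_set"

definition Y_space :: "(nat \<Rightarrow> real) \<Rightarrow> (nat \<Rightarrow> real) \<Rightarrow> (nat \<Rightarrow> real) \<Rightarrow> (real \<times> real) set" where
  "Y_space d a q = cantor_set \<times> UNIV -
     (\<Union>n. top_of_set (cantor_set \<times> UNIV) closure_of
            cantor_graph (\<lambda>c. jump_fun d a c + q n))"

definition Xi :: "real \<times> real \<Rightarrow> real \<times> real" where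
  "Xi = (\<lambda>(c, r). (c, arctan r / pi + 1 / 2))"

definition X3 :: "(nat \<Rightarrow> real) \<Rightarrow> (nat \<Rightarrow> real) \<Rightarrow> (nat \<Rightarrow> real) \<Rightarrow> (real \<times> real) set" where
  "X3 d a q = Xi ` Y_space d a q"

definition knaster_diagonal :: "(real \<times> real) set" where
  "knaster_diagonal = (\<lambda>x. (x, x)) ` cantor_set"

text \<open>
  The map \<open>knaster_chart i\<close> is only meaningful on \<open>cantor_set \<times> {0<..<1}\<close>; it parametrises
  the \<open>i\<close>-th family of open two-segment arcs joining the diagonal points
  \<open>(x, x)\<close> and \<open>(y, y)\<close> in the rectilinear bucket-handle continuum. The two branches
  agree at \<open>t = 1/2\<close>.
\<close>

definition knaster_chart :: "nat \<Rightarrow> real \<times> real \<Rightarrow> real \<times> real" where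
  "knaster_chart i = (\<lambda>(c, t).
     if i = 0 then
       let x = c / 3; y = 1 - x in
         if t \<le> 1 / 2 then (x, x + 2 * t * (y - x))
         else (x + (2 * t - 1) * (y - x), y)
     else
       let x = 2 / 3 ^ i + c / 3 ^ (i + 1); y = 5 / 3 ^ i - x in
         if t \<le> 1 / 2 then (x + 2 * t * (y - x), x)
         else (y, x + (2 * t - 1) * (y - x)))"

definition W_set :: "(real \<times> real) set \<Rightarrow> (real \<times> real) set" where
  "W_set X = knaster_diagonal \<union> (\<Union>i. knaster_chart i ` X)"

definition biconnected_space :: "'a topology \<Rightarrow> bool" where
  "biconnected_space T \<longleftrightarrow> connected_space T \<and>
     \<not> (\<exists>A B. A \<union> B = topspace T \<and> A \<inter> B = {} \<and>
           connectedin T A \<and> connectedin T B \<and>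
           (\<exists>x\<in>A. \<exists>y\<in>A. x \<noteq> y) \<and> (\<exists>x\<in>B. \<exists>y\<in>B. x \<noteq> y))"

end

theory Submission
  imports Defs
begin

text \<open>
  It suffices to split \<open>W\<close> into two disjoint connected nondegenerate sets. The splitting is
  done independently on the diagonal and on the arcs. On the diagonal, the rational points of the
  Cantor set go to one part and the irrational ones to the other. On the arcs, a Bernstein-type set
  \<open>T\<close> is used: pulled back to \<open>Y\<close> by each of the charts, both \<open>T\<close> and its complement meet
  every uncountable set \<open>F \<inter> Y\<close> with \<open>F\<close> closed. Such a \<open>T\<close> exists because \<open>F \<inter> Y\<close> is
  a \<open>G\<^sub>\<delta>\<close> set, hence of size continuum when uncountable, and there are only continuum many
  closed sets.

  The point is that a Bernstein part \<open>A\<close> of \<open>Y\<close> inherits from \<open>Y\<close> the property that no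
  relatively clopen set splits a vertical fibre (\<open>fibre_not_split\<close>). If open sets \<open>U\<close>, \<open>V\<close>
  separate \<open>A\<close> and both meet one fibre, then they both meet all nearby fibres. The set
  \<open>F = -(U \<union> V)\<close> misses \<open>A\<close>, so it contains only countably many points of \<open>Y\<close>. Hence,
  apart from countably many fibres, \<open>F\<close> meets a nearby fibre over \<open>c\<close> only in the countable
  set of points \<open>f(c) + q\<^sub>n\<close>, and the common boundary of \<open>U\<close> and \<open>V\<close> in that fibre
  is a nonempty countable closed set. It therefore has an isolated point, at which \<open>U\<close> and \<open>V\<close>
  lie on opposite sides. By the Baire category theorem a single \<open>n\<close>, a single radius \<open>e\<close> and a
  single orientation serve a dense set of \<open>c\<close> in some open part of the Cantor set. At a point
  \<open>d\<^sub>k\<close> of that part where the jump \<open>a\<^sub>k\<close> is less than \<open>e\<close>, the limits from the left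
  and from the right contradict each other: the whole jump interval is left uncovered by
  \<open>U \<union> V\<close>, although it contains uncountably many points of \<open>Y\<close>.

  Given this, consider the part of \<open>W\<close> made of a set \<open>Z\<close> of diagonal points and of Bernstein
  parts of all arcs, where a diagonal point belongs to \<open>Z\<close> exactly when the other end of an arc
  through it does. In a separation by open sets each arc lies on one side, and this side
  depends locally constantly on the arc. Arcs with an end in \<open>Z\<close> lie on the side of that end,
  so the side is transported along chains of arcs. Starting near the point \<open>0\<close>, such chains reach
  all of \<open>Z\<close> (\<open>arc_invariant_propagates\<close>), which is the combinatorial core of the density of the
  composants of the bucket-handle continuum. As \<open>Z\<close> is dense, everything is on one side, and
  the part is connected (\<open>connected_knaster_part\<close>). The rational and the irrational points are
  both admissible choices of \<open>Z\<close>.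
\<close>

section \<open>Bernstein sets and perfect sets\<close>

text \<open>
  Transfinite recursion along a well-order of \<open>I\<close> of minimal type: at stage \<open>i\<close> fewer than
  \<open>|I|\<close> points have been used, so the set \<open>A i\<close> still contains a new one.
\<close>

lemma injective_choice_of_large_sets:
  includes cardinal_syntax
  fixes A :: "'i \<Rightarrow> 'a set"
  assumes large: "\<And>i. i \<in> I \<Longrightarrow> I \<lesssim> A i"
  obtains g where "inj_on g I" "\<And>i. i \<in> I \<Longrightarrow> g i \<in> A i"
proof -
  let ?r = "|I|"
  have wo: "Well_order ?r" and F: "Field ?r = I" using card_of_Well_order by (auto simp: Field_card_of card_of_well_order_on)
  have wf: "wf (?r - Id)"
    using wo by (simp add: well_order_on_def)
  define g where "g = wfrec (?r - Id) (\<lambda>g i. SOME x. x \<in> A i - g ` underS ?r i)"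
  have g_eq: "g i = (SOME x. x \<in> A i - g ` underS ?r i)" for i
  proof -
    have "cut g (?r - Id) i ` underS ?r i = g ` underS ?r i"
      by (rule image_cong) (auto simp: underS_def cut_apply)
    then show ?thesis
      unfolding g_def using wfrec[OF wf, of "\<lambda>g i. SOME x. x \<in> A i - g ` underS ?r i" i]
      by simp
  qed
  have g_in: "g i \<in> A i - g ` underS ?r i" if "i \<in> I" for i
  proof -
    have "|underS ?r i| <o ?r"
      using card_of_underS[OF card_of_Card_order, of i I] that F by simp
    moreover have "?r \<le>o |A i|"
      using large[OF that] by (auto simp: lepoll_def card_of_ordLeq)
    moreover have "|g ` underS ?r i| \<le>o |underS ?r i|" by (rule card_of_image)
    ultimately have "|g ` underS ?r i| <o |A i|"
      using ordLeq_ordLess_trans ordLess_ordLeq_trans by blast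
    then have "\<not> A i \<subseteq> g ` underS ?r i"
      using card_of_mono1 not_ordLess_ordLeq by blast
    then have "\<exists>x. x \<in> A i - g ` underS ?r i" by blast
    then show ?thesis
      by (subst g_eq) (rule someI_ex)
  qed
  have "inj_on g I"
  proof (rule inj_onI, rule ccontr)
    fix i j assume ij: "i \<in> I" "j \<in> I" "g i = g j" "i \<noteq> j"
    then have "(i, j) \<in> ?r \<or> (j, i) \<in> ?r"
      using wo F by (metis wo_rel.TOTALS wo_rel.intro)
    then have "i \<in> underS ?r j \<or> j \<in> underS ?r i"
      using ij by (auto simp: underS_def)
    then show False using g_in[of i] g_in[of j] ij by (metis DiffD2 imageI)
  qed
  then show ?thesis using that g_in by blast
qed

text \<open>
  The complement of a closed set is determined by the members of a countable base that it contains.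
\<close>

lemma closed_sets_lepoll_reals:
  "{F :: 'a::second_countable_topology set. closed F} \<lesssim> (UNIV :: real set)"
proof -
  obtain B :: "'a set set" where B: "countable B" "topological_basis B"
    using ex_countable_basis by blast
  define k where "k F = to_nat_on B ` {U \<in> B. U \<subseteq> - F}" for F :: "'a set"
  have rec: "- F = \<Union>{U \<in> B. to_nat_on B U \<in> k F}" if "closed F" for F
  proof -
    have "{U \<in> B. to_nat_on B U \<in> k F} = {U \<in> B. U \<subseteq> - F}"
      using B(1) by (auto simp: k_def)
    moreover have "open (- F)" using that by auto
    then have "- F = \<Union>{U \<in> B. U \<subseteq> - F}"
      using topological_basisE[OF B(2)] by (blast intro: topological_basisE[OF B(2)])
    ultimately show ?thesis by simp
  qed
  have "inj_on k {F. closed F}"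
  proof (rule inj_onI)
    fix F G assume "F \<in> {F. closed F}" "G \<in> {F. closed F}" "k F = k G"
    then have "- F = - G" using rec[of F] rec[of G] by simp
    then show "F = G" by simp
  qed
  then have "{F :: 'a set. closed F} \<lesssim> (UNIV :: nat set set)"
    by (auto simp: lepoll_def)
  then show ?thesis using nat_sets_eqpoll_reals lepoll_trans2 by blast
qed

lemma times_lepoll_reals:
   "(UNIV :: real set) \<times> (UNIV :: bool set) \<lesssim> (UNIV :: real set)"
   "(UNIV :: nat set) \<times> (UNIV :: real set) \<lesssim> (UNIV :: real set)"
proof -
  have r: "infinite (UNIV :: real set)" by (simp add: infinite_UNIV_char_0)
  have *: "(UNIV :: real set) \<times> (UNIV :: real set) \<lesssim> (UNIV :: real set)"
    using card_of_Times_same_infinite[OF r] by (simp add: eqpoll_iff_card_of_ordIso eqpoll_imp_lepoll)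
  have "(UNIV :: bool set) \<lesssim> (UNIV :: real set)"
    using r by (meson finite_lepoll_infinite finite)
  then show "(UNIV :: real set) \<times> (UNIV :: bool set) \<lesssim> (UNIV :: real set)"
    using times_lepoll_mono[OF lepoll_refl] lepoll_trans * by blast
  have "(UNIV :: nat set) \<lesssim> (UNIV :: real set)"
    using r infinite_le_lepoll by blast
  then show "(UNIV :: nat set) \<times> (UNIV :: real set) \<lesssim> (UNIV :: real set)"
    using times_lepoll_mono[OF _ lepoll_refl] lepoll_trans * by blast
qed

text \<open>
  Two distinct points are reserved in each \<open>A i\<close>, injectively over all \<open>i\<close>; the set \<open>T\<close>
  collects the first of each pair and avoids the second.
\<close>

lemma bernstein_set:
  fixes A :: "'i \<Rightarrow> 'a set"
  assumes I: "I \<lesssim> (UNIV :: real set)"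
    and large: "\<And>i. i \<in> I \<Longrightarrow> (UNIV :: real set) \<lesssim> A i"
  shows "\<exists>T. \<forall>i\<in>I. A i \<inter> T \<noteq> {} \<and> A i - T \<noteq> {}"
proof -
  have "I \<times> (UNIV :: bool set) \<lesssim> (UNIV :: real set)"
    using times_lepoll_mono[OF I lepoll_refl] times_lepoll_reals(1) lepoll_trans by blast
  then have "I \<times> (UNIV :: bool set) \<lesssim> A (fst p)" if "p \<in> I \<times> (UNIV :: bool set)" for p
    using lepoll_trans[OF _ large[of "fst p"]] that by (auto simp: mem_Times_iff)
  then obtain g where g: "inj_on g (I \<times> (UNIV :: bool set))"
      "\<And>p. p \<in> I \<times> (UNIV :: bool set) \<Longrightarrow> g p \<in> A (fst p)"
    using injective_choice_of_large_sets[of "I \<times> (UNIV :: bool set)" "A \<circ> fst"] by auto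
  define T where "T = g ` (I \<times> {True})"
  have "g (i, True) \<in> A i \<inter> T" if "i \<in> I" for i
    using g(2)[of "(i, True)"] that by (auto simp: T_def)
  moreover have "g (i, False) \<in> A i - T" if "i \<in> I" for i
  proof -
    have "g (i, False) \<noteq> g (j, True)" if "j \<in> I" for j
      using inj_onD[OF g(1), of "(i, False)" "(j, True)"] that \<open>i \<in> I\<close> by auto
    then show ?thesis using g(2)[of "(i, False)"] that by (auto simp: T_def)
  qed
  ultimately show ?thesis by blast
qed

text \<open>
  Removing all relatively open countable pieces leaves a nonempty perfect \<open>G\<^sub>\<delta>\<close> set, which is
  completely metrizable and therefore has the size of the continuum.
\<close>

lemma uncountable_gdelta_lepoll:
  fixes S :: "(real \<times> real) set"
  assumes S: "gdelta_in euclidean S" and unc: "uncountable S"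
  shows "(UNIV :: real set) \<lesssim> S"
proof -
  obtain B :: "(real \<times> real) set set" where B: "countable B" "topological_basis B"
    using ex_countable_basis by blast
  define G where "G = \<Union>{U \<in> B. countable (S \<inter> U)}"
  have cG: "countable (S \<inter> G)"
  proof -
    have "S \<inter> G = (\<Union>U\<in>{U \<in> B. countable (S \<inter> U)}. S \<inter> U)" by (auto simp: G_def)
    moreover have "countable (\<Union>U\<in>{U \<in> B. countable (S \<inter> U)}. S \<inter> U)"
      using B(1) by (intro countable_UN) auto
    ultimately show ?thesis by simp
  qed
  have "open G" using B(2) by (auto simp: G_def intro!: open_Union topological_basis_open)
  define P where "P = S - G"
  have uncP: "uncountable (P \<inter> U)" if U: "open U" "x \<in> P" "x \<in> U" for x U
  proof
    assume c: "countable (P \<inter> U)"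
    obtain V where V: "V \<in> B" "x \<in> V" "V \<subseteq> U"
      using topological_basisE[OF B(2) U(1,3)] by blast
    have "S \<inter> V \<subseteq> (P \<inter> U) \<union> (S \<inter> G)" using V by (auto simp: P_def)
    then have "countable (S \<inter> V)" using c cG by (metis countable_Un countable_subset)
    then have "x \<in> G" using V by (auto simp: G_def)
    then show False using that by (auto simp: P_def)
  qed
  have "closed (- G)" using \<open>open G\<close> by auto
  then have "gdelta_in euclidean (- G)"
    using closed_imp_gdelta_in[OF metrizable_space_euclidean, of "- G"] by simp
  then have "gdelta_in euclidean P"
    using gdelta_in_Int[OF S] by (simp add: P_def Diff_eq)
  then have cm: "completely_metrizable_space (top_of_set P)"
    by (intro completely_metrizable_space_gdelta_in completely_metrizable_space_euclidean)
  have "top_of_set P derived_set_of P = P"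
  proof -
    have "x \<in> top_of_set P derived_set_of P" if x: "x \<in> P" for x
    proof -
      have "\<exists>y. y \<noteq> x \<and> y \<in> P \<and> y \<in> T" if T: "x \<in> T" "openin (top_of_set P) T" for T
      proof -
        obtain U where U: "open U" "T = P \<inter> U" using T by (auto simp: openin_open)
        then have "\<not> P \<inter> U \<subseteq> {x}" using uncP[of U x] x T by (metis IntD2 countable_empty countable_insert countable_subset)
        then show ?thesis using U by blast
      qed
      then show ?thesis using x by (auto simp: derived_set_of_def)
    qed
    moreover have "top_of_set P derived_set_of P \<subseteq> P"
      by (auto simp: derived_set_of_def)
    ultimately show ?thesis by blast
  qed
  moreover have "P \<noteq> {}"
  proof
    assume "P = {}"
    then have "S = S \<inter> G" by (auto simp: P_def)
    then show False using cG unc by simp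
  qed
  ultimately have "(UNIV :: real set) \<lesssim> P"
    using lepoll_perfect_set[of "top_of_set P" P] cm by blast
  then show ?thesis
    using lepoll_trans subset_imp_lepoll[of P S] by (auto simp: P_def)
qed

lemma uncountable_of_no_isolated_points:
  fixes S :: "real set"
  assumes S: "closed S" "S \<noteq> {}" and acc: "\<And>x. x \<in> S \<Longrightarrow> x islimpt S"
  shows "uncountable S"
proof -
  have cm: "completely_metrizable_space (euclidean :: real topology)"
    by (rule completely_metrizable_space_euclidean)
  have "euclidean derived_set_of S = S"
  proof -
    have "euclidean derived_set_of S = {x. x islimpt S}"
      by (auto simp: derived_set_of_def islimpt_def)
    then show ?thesis using S acc closed_limpt by blast
  qed
  then have "(UNIV :: real set) \<lesssim> S"
    using lepoll_perfect_set[of euclidean S] cm S by blast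
  then show ?thesis using countable_lepoll uncountable_UNIV_real by blast
qed

text \<open>
  The common boundary of \<open>u\<close> and \<open>v\<close> is closed, nonempty by connectedness of the line, and
  countable, so it has an isolated point. Next to such a point each of the two sides belongs to
  only one of the sets, and it cannot be the same set on both sides.
\<close>

lemma isolated_common_boundary_point:
  fixes u v :: "real set"
  assumes "open u" "open v" "u \<inter> v = {}" "u \<noteq> {}" "v \<noteq> {}" and c: "countable (- (u \<union> v))"
  obtains p e where "p \<notin> u \<union> v" "0 < e"
    "{p - e<..<p} \<inter> u = {} \<and> {p<..<p + e} \<inter> v = {} \<or>
     {p - e<..<p} \<inter> v = {} \<and> {p<..<p + e} \<inter> u = {}"
proof -
  define B where "B = closure u \<inter> closure v"
  have dense: "closure u \<union> closure v = UNIV"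
  proof -
    have "\<exists>y\<in>u \<union> v. dist y x < e" if "0 < e" for x e
      using ball_minus_countable_nonempty[OF c that, of x] by (force simp: dist_commute)
    then have "x \<in> closure (u \<union> v)" for x unfolding closure_approachable by blast
    then have "closure (u \<union> v) = UNIV" by blast
    then show ?thesis by (simp add: closure_Un)
  qed
  have disj: "u \<inter> closure v = {}" "v \<inter> closure u = {}"
    using assms(1-3) open_Int_closure_eq_empty[of u v] open_Int_closure_eq_empty[of v u] by auto
  have Bc: "B \<subseteq> - (u \<union> v)" using disj closure_subset by (auto simp: B_def)
  have "B \<noteq> {}"
    using connected_closedD[of UNIV "closure u" "closure v"] dense assms(4,5)
    by (auto simp: B_def)
  have "closed B" by (auto simp: B_def)
  have "\<not> (\<forall>x\<in>B. x islimpt B)"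
    using uncountable_of_no_isolated_points[OF \<open>closed B\<close> \<open>B \<noteq> {}\<close>] countable_subset[OF Bc c] by blast
  then obtain p where p: "p \<in> B" "\<not> p islimpt B" by blast
  then obtain e where e: "0 < e" "\<And>x. x \<in> B \<Longrightarrow> x \<noteq> p \<Longrightarrow> e \<le> dist x p"
    by (auto simp: islimpt_approachable not_less)
  have side: "I \<inter> closure u = {} \<or> I \<inter> closure v = {}"
    if "connected I" "p \<notin> I" "I \<subseteq> ball p e" for I
  proof (rule ccontr)
    assume "\<not> ?thesis"
    then have "closure u \<inter> closure v \<inter> I \<noteq> {}"
      using connected_closedD[OF \<open>connected I\<close>, of "closure u" "closure v"] dense by blast
    then obtain x where "x \<in> B" "x \<in> I" by (auto simp: B_def)
    moreover from this have "dist x p < e" "x \<noteq> p" using that by (auto simp: dist_commute)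
    ultimately show False using e(2)[of x] by simp
  qed
  let ?L = "{p - e<..<p}" and ?R = "{p<..<p + e}"
  have L: "?L \<inter> closure u = {} \<or> ?L \<inter> closure v = {}"
    by (rule side) (auto simp: dist_real_def)
  have R: "?R \<inter> closure u = {} \<or> ?R \<inter> closure v = {}"
    by (rule side) (auto simp: dist_real_def)
  have both: False if "?L \<inter> closure w = {}" "?R \<inter> closure w = {}" "p \<in> closure w" "p \<notin> w" for w
  proof -
    obtain y where y: "y \<in> w" "dist y p < e"
      using \<open>p \<in> closure w\<close> e(1) unfolding closure_approachable by blast
    then have "y \<in> ?L \<or> y \<in> ?R" using \<open>p \<notin> w\<close> by (cases "y < p"; cases "y = p") (auto simp: dist_real_def)
    then show False using that y(1) closure_subset by blast
  qed
  have "p \<in> closure u" "p \<in> closure v" "p \<notin> u" "p \<notin> v" using p(1) Bc by (auto simp: B_def)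
  then have "?L \<inter> closure u = {} \<and> ?R \<inter> closure v = {} \<or> ?L \<inter> closure v = {} \<and> ?R \<inter> closure u = {}"
    using both[of u] both[of v] L R by blast
  then show ?thesis
    using that[of p e] e(1) \<open>p \<notin> u\<close> \<open>p \<notin> v\<close> closure_subset[of u] closure_subset[of v] by blast
qed

section \<open>The Cantor set\<close>

text \<open>
  The defining recursion trisects the intervals reached last. For induction on the self-similarity of
  the Cantor set, the first step is split off instead: the next stage consists of two copies of
  the present one, scaled by one third.
\<close>

lemma cantor_intervals_Suc_image:
  "cantor_intervals (Suc n) =
     (\<lambda>(u, v). (u / 3, v / 3)) ` cantor_intervals n
     \<union> (\<lambda>(u, v). (2 / 3 + u / 3, 2 / 3 + v / 3)) ` cantor_intervals n"
proof (induction n)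
  case 0
  show ?case by (simp add: insert_commute)
next
  case (Suc n)
  have "cantor_intervals (Suc (Suc n)) =
     (\<Union>(u, v)\<in>cantor_intervals (Suc n). {(u, (2 * u + v) / 3), ((u + 2 * v) / 3, v)})"
    by (rule cantor_intervals.simps(2))
  also have "\<dots> =
      (\<Union>(u, v)\<in>cantor_intervals n. {(u / 3, (2 * (u / 3) + v / 3) / 3), ((u / 3 + 2 * (v / 3)) / 3, v / 3)})
     \<union> (\<Union>(u, v)\<in>cantor_intervals n. {(2 / 3 + u / 3, (2 * (2 / 3 + u / 3) + (2 / 3 + v / 3)) / 3),
          ((2 / 3 + u / 3 + 2 * (2 / 3 + v / 3)) / 3, 2 / 3 + v / 3)})"
    unfolding Suc.IH by (simp add: UN_Un case_prod_unfold)
  also have "\<dots> = (\<lambda>(u, v). (u / 3, v / 3)) ` cantor_intervals (Suc n)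
     \<union> (\<lambda>(u, v). (2 / 3 + u / 3, 2 / 3 + v / 3)) ` cantor_intervals (Suc n)"
    by (simp add: image_UN case_prod_unfold add_divide_distrib)
  finally show ?case .
qed

lemma cantor_intervals_SucE:
  assumes "(u, v) \<in> cantor_intervals (Suc n)"
  obtains u' v' where "(u', v') \<in> cantor_intervals n" "u = u'" "v = (2 * u' + v') / 3"
  | u' v' where "(u', v') \<in> cantor_intervals n" "u = (u' + 2 * v') / 3" "v = v'"
  using assms by auto

lemma cantor_intervals_SucI:
  assumes "(u, v) \<in> cantor_intervals n"
  shows "(u, (2 * u + v) / 3) \<in> cantor_intervals (Suc n)"
    and "((u + 2 * v) / 3, v) \<in> cantor_intervals (Suc n)"
  using assms by force+

lemma cantor_intervals_length:
  "(u, v) \<in> cantor_intervals n \<Longrightarrow> v - u = (1 / 3) ^ n"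
proof (induction n arbitrary: u v)
  case (Suc n)
  from Suc.prems show ?case
  proof (cases rule: cantor_intervals_SucE)
    case (1 u' v')
    then have "v - u = (v' - u') / 3" by (simp add: field_simps)
    then show ?thesis using Suc.IH[OF 1(1)] by simp
  next
    case (2 u' v')
    then have "v - u = (v' - u') / 3" by (simp add: field_simps)
    then show ?thesis using Suc.IH[OF 2(1)] by simp
  qed
qed auto

lemma cantor_intervals_bounds:
  "(u, v) \<in> cantor_intervals n \<Longrightarrow> 0 \<le> u \<and> u < v \<and> v \<le> 1"
proof (induction n arbitrary: u v)
  case (Suc n)
  from Suc.prems show ?case
    by (cases rule: cantor_intervals_SucE) (auto dest: Suc.IH)
qed auto

lemma cantor_gaps_selfsimilar:
  "cantor_gaps = {(1 / 3, 2 / 3)} \<union> (\<lambda>(u, v). (u / 3, v / 3)) ` cantor_gaps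
     \<union> (\<lambda>(u, v). (2 / 3 + u / 3, 2 / 3 + v / 3)) ` cantor_gaps"
proof -
  define mid where "mid = (\<lambda>(u, v). ((2 * u + v) / 3, (u + 2 * v) / 3 :: real))"
  have g: "cantor_gaps = (\<Union>n. mid ` cantor_intervals n)"
    by (simp add: cantor_gaps_def mid_def)
  have "(\<Union>n. mid ` cantor_intervals n) =
     mid ` cantor_intervals 0 \<union> (\<Union>n. mid ` cantor_intervals (Suc n))"
    by (subst UNIV_nat_eq) auto
  also have "\<dots> = {(1 / 3, 2 / 3)} \<union> (\<lambda>(u, v). (u / 3, v / 3)) ` (\<Union>n. mid ` cantor_intervals n)
     \<union> (\<lambda>(u, v). (2 / 3 + u / 3, 2 / 3 + v / 3)) ` (\<Union>n. mid ` cantor_intervals n)"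
    unfolding cantor_intervals_Suc_image image_Un UN_Un_distrib image_UN image_image
    by (simp add: mid_def case_prod_unfold add_divide_distrib Un_assoc)
  finally show ?thesis by (simp add: g)
qed

lemma cantor_set_bounds: "x \<in> cantor_set \<Longrightarrow> 0 \<le> x \<and> x \<le> 1"
  by (auto simp: cantor_set_def)

lemma cantor_gaps_bounds: "(u, v) \<in> cantor_gaps \<Longrightarrow> 0 \<le> u \<and> u < v \<and> v \<le> 1"
  by (auto simp: cantor_gaps_def dest!: cantor_intervals_bounds)

lemma cantor_set_iff:
  "x \<in> cantor_set \<longleftrightarrow> 0 \<le> x \<and> x \<le> 1 \<and> (\<forall>u v. (u, v) \<in> cantor_gaps \<longrightarrow> x \<le> u \<or> v \<le> x)"
  by (auto simp: cantor_set_def not_less) force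

lemma cantor_gaps_cases:
  assumes "(u, v) \<in> cantor_gaps"
  obtains "u = 1 / 3" "v = 2 / 3"
  | u' v' where "(u', v') \<in> cantor_gaps" "u = u' / 3" "v = v' / 3"
  | u' v' where "(u', v') \<in> cantor_gaps" "u = 2 / 3 + u' / 3" "v = 2 / 3 + v' / 3"
  using assms by (subst (asm) cantor_gaps_selfsimilar) auto

lemma cantor_gaps_intros:
  "(1 / 3, 2 / 3) \<in> cantor_gaps"
  "(u, v) \<in> cantor_gaps \<Longrightarrow> (u / 3, v / 3) \<in> cantor_gaps"
  "(u, v) \<in> cantor_gaps \<Longrightarrow> (2 / 3 + u / 3, 2 / 3 + v / 3) \<in> cantor_gaps"
  by (subst cantor_gaps_selfsimilar; force)+


lemma cantor_set_left: "x \<in> cantor_set \<Longrightarrow> x / 3 \<in> cantor_set"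
  unfolding cantor_set_iff
proof (intro conjI allI impI)
  fix u v assume x: "0 \<le> x \<and> x \<le> 1 \<and> (\<forall>u v. (u, v) \<in> cantor_gaps \<longrightarrow> x \<le> u \<or> v \<le> x)"
    and "(u, v) \<in> cantor_gaps"
  from this(2) show "x / 3 \<le> u \<or> v \<le> x / 3"
  proof (cases rule: cantor_gaps_cases)
    case (2 u' v')
    then show ?thesis using x by fastforce
  next
    case (3 u' v')
    then show ?thesis using x cantor_gaps_bounds[of u' v'] by auto
  qed (use x in auto)
qed auto

lemma cantor_set_right: "x \<in> cantor_set \<Longrightarrow> 2 / 3 + x / 3 \<in> cantor_set"
  unfolding cantor_set_iff
proof (intro conjI allI impI)
  fix u v assume x: "0 \<le> x \<and> x \<le> 1 \<and> (\<forall>u v. (u, v) \<in> cantor_gaps \<longrightarrow> x \<le> u \<or> v \<le> x)"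
    and "(u, v) \<in> cantor_gaps"
  from this(2) show "2 / 3 + x / 3 \<le> u \<or> v \<le> 2 / 3 + x / 3"
  proof (cases rule: cantor_gaps_cases)
    case (2 u' v')
    then show ?thesis using x cantor_gaps_bounds[of u' v'] by auto
  next
    case (3 u' v')
    then show ?thesis using x by fastforce
  qed (use x in auto)
qed auto

lemma cantor_set_cases:
  assumes "x \<in> cantor_set"
  obtains c where "c \<in> cantor_set" "x = c / 3" | c where "c \<in> cantor_set" "x = 2 / 3 + c / 3"
proof -
  have x: "0 \<le> x" "x \<le> 1" "\<And>u v. (u, v) \<in> cantor_gaps \<Longrightarrow> x \<le> u \<or> v \<le> x"
    using assms by (auto simp: cantor_set_iff)
  from x(3)[OF cantor_gaps_intros(1)] show ?thesis
  proof
    assume "x \<le> 1 / 3"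
    moreover have "3 * x \<le> u \<or> v \<le> 3 * x" if "(u, v) \<in> cantor_gaps" for u v
      using x(3)[OF cantor_gaps_intros(2)[OF that]] by auto
    ultimately have "3 * x \<in> cantor_set" using x by (auto simp: cantor_set_iff)
    then show ?thesis using that(1)[of "3 * x"] by simp
  next
    assume "2 / 3 \<le> x"
    moreover have "3 * x - 2 \<le> u \<or> v \<le> 3 * x - 2" if "(u, v) \<in> cantor_gaps" for u v
      using x(3)[OF cantor_gaps_intros(3)[OF that]] by auto
    ultimately have "3 * x - 2 \<in> cantor_set" using x by (auto simp: cantor_set_iff)
    then show ?thesis using that(2)[of "3 * x - 2"] by (simp add: diff_divide_distrib)
  qed
qed

lemma cantor_intervals_reflect:
  "(u, v) \<in> cantor_intervals n \<Longrightarrow> (1 - v, 1 - u) \<in> cantor_intervals n"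
proof (induction n arbitrary: u v)
  case (Suc n)
  from Suc.prems show ?case
  proof (cases rule: cantor_intervals_SucE)
    case (1 u' v')
    then have "(1 - v, 1 - u) = (((1 - v') + 2 * (1 - u')) / 3, 1 - u')" by (simp add: field_simps)
    then show ?thesis using cantor_intervals_SucI[OF Suc.IH[OF 1(1)]] by metis
  next
    case (2 u' v')
    then have "(1 - v, 1 - u) = (1 - v', (2 * (1 - v') + (1 - u')) / 3)" by (simp add: field_simps)
    then show ?thesis using cantor_intervals_SucI[OF Suc.IH[OF 2(1)]] by metis
  qed
qed auto

lemma cantor_gaps_reflect:
  assumes "(u, v) \<in> cantor_gaps" shows "(1 - v, 1 - u) \<in> cantor_gaps"
proof -
  obtain n u' v' where uv: "(u', v') \<in> cantor_intervals n"
      "u = (2 * u' + v') / 3" "v = (u' + 2 * v') / 3"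
    using assms by (auto simp: cantor_gaps_def)
  have "(1 - v, 1 - u) = ((2 * (1 - v') + (1 - u')) / 3, ((1 - v') + 2 * (1 - u')) / 3)"
    by (simp add: uv field_simps)
  then show ?thesis using cantor_intervals_reflect[OF uv(1)]
    unfolding cantor_gaps_def by force
qed

lemma cantor_set_reflect:
  assumes "x \<in> cantor_set" shows "1 - x \<in> cantor_set"
proof -
  have "1 - x \<le> u \<or> v \<le> 1 - x" if "(u, v) \<in> cantor_gaps" for u v
    using cantor_gaps_reflect[OF that] assms unfolding cantor_set_iff by force
  then show ?thesis using assms by (auto simp: cantor_set_iff)
qed

lemma zero_in_cantor_set: "0 \<in> cantor_set"
  using cantor_gaps_bounds by (auto simp: cantor_set_iff)

lemma one_in_cantor_set: "1 \<in> cantor_set"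
  using cantor_set_reflect[OF zero_in_cantor_set] by simp

lemma closed_cantor_set: "closed cantor_set"
  unfolding cantor_set_def by (intro closed_Diff open_UN) auto

lemma cantor_interval_ends_in_cantor_set:
  "(u, v) \<in> cantor_intervals n \<Longrightarrow> u \<in> cantor_set \<and> v \<in> cantor_set"
proof (induction n arbitrary: u v)
  case 0
  then show ?case using zero_in_cantor_set one_in_cantor_set by simp
next
  case (Suc n)
  then show ?case
    unfolding cantor_intervals_Suc_image using cantor_set_left cantor_set_right by auto
qed

lemma cantor_interval_ends_are_endpoints:
  "(u, v) \<in> cantor_intervals n \<Longrightarrow> u \<notin> cantor_nonendpoints \<and> v \<notin> cantor_nonendpoints"
proof (induction n arbitrary: u v)
  case 0
  then show ?case by (simp add: cantor_nonendpoints_def)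
next
  case (Suc n)
  have mid: "(2 * u' + v') / 3 \<notin> cantor_nonendpoints \<and> (u' + 2 * v') / 3 \<notin> cantor_nonendpoints"
    if "(u', v') \<in> cantor_intervals n" for u' v'
  proof -
    have "((2 * u' + v') / 3, (u' + 2 * v') / 3) \<in> cantor_gaps"
      using that by (force simp: cantor_gaps_def)
    then show ?thesis by (auto simp only: cantor_nonendpoints_def)
  qed
  from Suc.prems show ?case
    by (cases rule: cantor_intervals_SucE) (use Suc.IH mid in blast)+
qed

lemma in_cantor_interval:
  assumes "x \<in> cantor_set"
  shows "\<exists>u v. (u, v) \<in> cantor_intervals n \<and> u \<le> x \<and> x \<le> v"
proof (induction n)
  case 0
  then show ?case using assms by (simp add: cantor_set_iff)
next
  case (Suc n)
  then obtain u v where uv: "(u, v) \<in> cantor_intervals n" "u \<le> x" "x \<le> v" by blast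
  then have "((2 * u + v) / 3, (u + 2 * v) / 3) \<in> cantor_gaps"
    by (force simp: cantor_gaps_def)
  then have "x \<le> (2 * u + v) / 3 \<or> (u + 2 * v) / 3 \<le> x"
    using assms unfolding cantor_set_iff by blast
  moreover have "(u, (2 * u + v) / 3) \<in> cantor_intervals (Suc n)"
      "((u + 2 * v) / 3, v) \<in> cantor_intervals (Suc n)"
    using cantor_intervals_SucI[OF uv(1)] by auto
  ultimately show ?case using uv by blast
qed

text \<open>
  A point of the Cantor set lies in an interval of every stage, whose ends are endpoints; a non-endpoint
  is therefore strictly between them.
\<close>

lemma cantor_nonendpoint_two_sided:
  assumes x: "x \<in> cantor_nonendpoints" and e: "0 < e"
  obtains u v where "u \<in> cantor_set" "v \<in> cantor_set" "x - e < u" "u < x" "x < v" "v < x + e"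
proof -
  have xC: "x \<in> cantor_set" using x by (simp add: cantor_nonendpoints_def)
  obtain n where n: "(1 / 3) ^ n < e"
    using real_arch_pow_inv[OF e, of "1 / 3"] by auto
  obtain u v where uv: "(u, v) \<in> cantor_intervals n" "u \<le> x" "x \<le> v"
    using in_cantor_interval[OF xC] by blast
  have "u \<noteq> x" "v \<noteq> x" using cantor_interval_ends_are_endpoints[OF uv(1)] x by auto
  moreover have "v - u < e" using cantor_intervals_length[OF uv(1)] n by simp
  ultimately show ?thesis
    using that[of u v] uv cantor_interval_ends_in_cantor_set[OF uv(1)] by auto
qed

text \<open>
  By self-similarity, an approximation within 1 by a point of \<open>T\<close> improves by a factor 3 at
  every step.
\<close>

lemma dense_in_cantor_set:
  assumes T: "T \<noteq> {}" "T \<subseteq> {0..1}"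
    and step: "\<And>t. t \<in> T \<Longrightarrow> t / 3 \<in> T" "\<And>t. t \<in> T \<Longrightarrow> 2 / 3 + t / 3 \<in> T"
  shows "cantor_set \<subseteq> closure T"
proof
  have approx: "\<exists>t\<in>T. \<bar>x - t\<bar> \<le> (1 / 3) ^ n" if "x \<in> cantor_set" for x n
    using that
  proof (induction n arbitrary: x)
    case 0
    then show ?case using T cantor_set_bounds[of x] by (force simp: abs_le_iff)
  next
    case (Suc n)
    from Suc.prems show ?case
    proof (cases rule: cantor_set_cases)
      case (1 c)
      with Suc.IH obtain t where "t \<in> T" "\<bar>c - t\<bar> \<le> (1 / 3) ^ n" by blast
      moreover have "\<bar>c / 3 - t / 3\<bar> = \<bar>c - t\<bar> / 3" by (simp flip: diff_divide_distrib)
      ultimately have "t \<in> T" "\<bar>c / 3 - t / 3\<bar> \<le> (1 / 3) ^ Suc n" by auto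
      then show ?thesis using 1 by (intro bexI[OF _ step(1)[of t]]) auto
    next
      case (2 c)
      with Suc.IH obtain t where "t \<in> T" "\<bar>c - t\<bar> \<le> (1 / 3) ^ n" by blast
      moreover have "\<bar>c / 3 - t / 3\<bar> = \<bar>c - t\<bar> / 3" by (simp flip: diff_divide_distrib)
      ultimately have "t \<in> T" "\<bar>c / 3 - t / 3\<bar> \<le> (1 / 3) ^ Suc n" by auto
      then show ?thesis using 2 by (intro bexI[OF _ step(2)[of t]]) auto
    qed
  qed
  fix x assume x: "x \<in> cantor_set"
  show "x \<in> closure T"
    unfolding closure_approachable
  proof (intro allI impI)
    fix e :: real assume "0 < e"
    then obtain n where "(1 / 3) ^ n < e"
      using real_arch_pow_inv[of e "1 / 3"] by auto
    with approx[OF x, of n] show "\<exists>y\<in>T. dist y x < e"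
      by (force simp: dist_real_def abs_minus_commute)
  qed
qed

lemma cantor_set_islimpt:
  assumes "x \<in> cantor_set" shows "x islimpt cantor_set"
proof -
  have one: "x \<in> cantor_set \<Longrightarrow> \<exists>y\<in>cantor_set. y \<noteq> x \<and> \<bar>y - x\<bar> \<le> (1 / 3) ^ n" for n x
  proof (induction n arbitrary: x)
    case 0
    then show ?case using zero_in_cantor_set one_in_cantor_set cantor_set_bounds[of x]
      by (cases "x = 0") (auto simp: abs_le_iff)
  next
    case (Suc n)
    from Suc.prems show ?case
    proof (cases rule: cantor_set_cases)
      case (1 c)
      with Suc.IH obtain t where "t \<in> cantor_set" "t \<noteq> c" "\<bar>t - c\<bar> \<le> (1 / 3) ^ n" by blast
      moreover have "\<bar>t / 3 - c / 3\<bar> = \<bar>t - c\<bar> / 3" by (simp flip: diff_divide_distrib)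
      ultimately have "t \<in> cantor_set" "t \<noteq> c" "\<bar>t / 3 - c / 3\<bar> \<le> (1 / 3) ^ Suc n" by auto
      then show ?thesis using 1
        by (intro bexI[OF _ cantor_set_left[of t]]) auto
    next
      case (2 c)
      with Suc.IH obtain t where "t \<in> cantor_set" "t \<noteq> c" "\<bar>t - c\<bar> \<le> (1 / 3) ^ n" by blast
      moreover have "\<bar>t / 3 - c / 3\<bar> = \<bar>t - c\<bar> / 3" by (simp flip: diff_divide_distrib)
      ultimately have "t \<in> cantor_set" "t \<noteq> c" "\<bar>t / 3 - c / 3\<bar> \<le> (1 / 3) ^ Suc n" by auto
      then show ?thesis using 2
        by (intro bexI[OF _ cantor_set_right[of t]]) auto
    qed
  qed
  show ?thesis unfolding islimpt_approachable
  proof (intro allI impI)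
    fix e :: real assume "0 < e"
    then obtain n where "(1 / 3) ^ n < e"
      using real_arch_pow_inv[of e "1 / 3"] by auto
    with one[OF assms, of n] show "\<exists>y\<in>cantor_set. y \<noteq> x \<and> dist y x < e"
      by (force simp: dist_real_def)
  qed
qed

text \<open>
  The closure of the trace on a small ball has no isolated points.
\<close>

lemma uncountable_cantor_set_Int_open:
  assumes "open U" "x \<in> cantor_set" "x \<in> U"
  shows "uncountable (cantor_set \<inter> U)"
proof -
  obtain e where e: "0 < e" "cball x e \<subseteq> U"
    using assms open_contains_cball by blast
  let ?A = "cantor_set \<inter> ball x e"
  have "y islimpt ?A" if "y \<in> ?A" for y
    unfolding islimpt_def
  proof (intro allI impI)
    fix T assume "y \<in> T" "open T"
    then have "y \<in> T \<inter> ball x e" "open (T \<inter> ball x e)" using that by auto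
    then show "\<exists>z\<in>?A. z \<in> T \<and> z \<noteq> y"
      using cantor_set_islimpt[of y] that unfolding islimpt_def by (meson IntD1 IntD2 IntI)
  qed
  then have "y islimpt ?A" if "y \<in> closure ?A" for y
    using that by (auto simp: closure_def)
  then have "y islimpt closure ?A" if "y \<in> closure ?A" for y
    using islimpt_subset[OF _ closure_subset] that by blast
  moreover have "x \<in> closure ?A"
    using assms(2) e(1) closure_subset[of ?A] by auto
  ultimately have "uncountable (closure ?A)"
    by (intro uncountable_of_no_isolated_points) auto
  moreover have "closure ?A \<subseteq> cantor_set \<inter> cball x e"
    using closed_cantor_set ball_subset_cball[of x e] by (intro closure_minimal) auto
  then have "closure ?A \<subseteq> cantor_set \<inter> U" using e(2) by blast
  ultimately show ?thesis
    using countable_subset by metis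
qed

section \<open>The arcs of the bucket-handle continuum\<close>

text \<open>
  The \<open>i\<close>-th family joins the diagonal points over \<open>arc_start i c\<close> and \<open>arc_end i c\<close>
  for \<open>c\<close> in the Cantor set. Family \<open>0\<close> pairs every point of the Cantor set with its mirror image about
  \<open>1 / 2\<close>; family \<open>i \<ge> 1\<close> pairs the points of the portion in
  \<open>[2 / 3\<^sup>i, 3 / 3\<^sup>i]\<close> with their mirror images about the midpoint of that interval.
\<close>

definition arc_start :: "nat \<Rightarrow> real \<Rightarrow> real" where
  "arc_start i c = (if i = 0 then c / 3 else 2 / 3 ^ i + c / 3 ^ (i + 1))"

definition arc_end :: "nat \<Rightarrow> real \<Rightarrow> real" where
  "arc_end i c = (if i = 0 then 1 else 5 / 3 ^ i) - arc_start i c"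

text \<open>
  A formula without the case distinction on \<open>t\<close>, from which continuity is immediate: the second
  coordinate (for \<open>i = 0\<close>) runs from start to end during the first half, the first coordinate
  during the second half.
\<close>

lemma knaster_chart_eq:
  "knaster_chart i (c, t) =
     (let x = arc_start i c; y = arc_end i c;
          p = x + max 0 (2 * t - 1) * (y - x); p' = x + min 1 (2 * t) * (y - x)
      in if i = 0 then (p, p') else (p', p))"
  by (auto simp: knaster_chart_def arc_start_def arc_end_def Let_def max_def min_def)

lemma arc_Suc:
  "arc_start (Suc n) c = (2 / 3 + c / 9) / 3 ^ n"
  "arc_end (Suc n) c = (1 - c / 9) / 3 ^ n"
  by (simp_all add: arc_start_def arc_end_def field_simps)

lemma arc_0: "arc_start 0 c = c / 3" "arc_end 0 c = 1 - c / 3"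
  by (simp_all add: arc_start_def arc_end_def)

lemma arc_start_less_end:
  assumes "c \<in> cantor_set" shows "arc_start i c < arc_end i c"
  using cantor_set_bounds[OF assms] by (cases i) (auto simp: arc_0 arc_Suc divide_strict_right_mono)

lemma cantor_set_scale: "c \<in> cantor_set \<Longrightarrow> c / 3 ^ n \<in> cantor_set"
proof (induction n)
  case (Suc n)
  have "c / 3 ^ Suc n = c / 3 ^ n / 3" by simp
  then show ?case using cantor_set_left[OF Suc.IH[OF Suc.prems]] by metis
qed simp

lemma arc_start_in_cantor_set:
  assumes "c \<in> cantor_set" shows "arc_start i c \<in> cantor_set"
proof (cases i)
  case (Suc n)
  have "2 / 3 + (c / 3) / 3 \<in> cantor_set"
    using assms cantor_set_left cantor_set_right by blast
  then show ?thesis using cantor_set_scale[of "2 / 3 + c / 9" n] by (simp add: Suc arc_Suc)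
qed (use assms cantor_set_left in \<open>simp add: arc_0\<close>)

lemma arc_end_in_cantor_set:
  assumes "c \<in> cantor_set" shows "arc_end i c \<in> cantor_set"
proof (cases i)
  case (Suc n)
  have "1 - (c / 3) / 3 \<in> cantor_set"
    using assms cantor_set_left cantor_set_reflect by blast
  then show ?thesis using cantor_set_scale[of "1 - c / 9" n] by (simp add: Suc arc_Suc)
qed (use assms cantor_set_left cantor_set_reflect in \<open>simp add: arc_0\<close>)

text \<open>
  Membership in \<open>Z\<close> is preserved along arcs; asking that it be also preserved between the parameter
  \<open>c\<close> and the ends makes \<open>Z\<close> self-similar, which matches \<open>C = C / 3 \<union> (1 - C / 3)\<close>.
\<close>

definition arc_invariant :: "real set \<Rightarrow> bool" where
  "arc_invariant Z \<longleftrightarrow> Z \<subseteq> cantor_set \<and>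
     (\<forall>i. \<forall>c\<in>cantor_set. (arc_start i c \<in> Z \<longleftrightarrow> c \<in> Z) \<and> (arc_end i c \<in> Z \<longleftrightarrow> c \<in> Z))"

lemma arc_invariant_third:
  "arc_invariant Z \<Longrightarrow> c \<in> cantor_set \<Longrightarrow> c / 3 \<in> Z \<longleftrightarrow> c \<in> Z"
  unfolding arc_invariant_def arc_0(1)[symmetric] by blast

lemma arc_invariant_reflect_third:
  "arc_invariant Z \<Longrightarrow> c \<in> cantor_set \<Longrightarrow> 1 - c / 3 \<in> Z \<longleftrightarrow> c \<in> Z"
  unfolding arc_invariant_def arc_0(2)[symmetric] by blast

lemma arc_invariant_cases:
  assumes Z: "arc_invariant Z" and z: "z \<in> Z"
  obtains c where "c \<in> Z" "z = c / 3" | c where "c \<in> Z" "z = 1 - c / 3"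
proof -
  have "z \<in> cantor_set" using assms by (auto simp: arc_invariant_def)
  then show ?thesis
  proof (cases rule: cantor_set_cases)
    case (1 c)
    then have "c \<in> Z" using arc_invariant_third[OF Z 1(1)] z by metis
    then show ?thesis using that(1) 1(2) by blast
  next
    case (2 c)
    have z': "z = 1 - (1 - c) / 3" using 2 by (simp add: field_simps)
    then have "1 - c \<in> Z"
      using arc_invariant_reflect_third[OF Z cantor_set_reflect[OF 2(1)]] z by metis
    then show ?thesis using that(2) z' by blast
  qed
qed

lemma arc_invariant_scale: "arc_invariant Z \<Longrightarrow> c \<in> Z \<Longrightarrow> c / 3 ^ n \<in> Z"
proof (induction n)
  case (Suc n)
  then have "c / 3 ^ n \<in> Z" "c / 3 ^ n \<in> cantor_set" by (auto simp: arc_invariant_def)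
  then show ?case using arc_invariant_third[OF Suc.prems(1), of "c / 3 ^ n"] by (simp add: field_simps)
qed auto

lemma arc_invariant_reflect:
  assumes Z: "arc_invariant Z" and "c \<in> Z" shows "1 - c \<in> Z"
  using assms
proof (cases rule: arc_invariant_cases)
  case (1 b)
  then have "b \<in> cantor_set" using Z by (auto simp: arc_invariant_def)
  then show ?thesis using arc_invariant_reflect_third[OF Z] 1 by metis
next
  case (2 b)
  then have "b \<in> cantor_set" using Z by (auto simp: arc_invariant_def)
  then show ?thesis using arc_invariant_third[OF Z] 2 by simp
qed

text \<open>
  The chains of arcs through points of \<open>Z\<close> carry \<open>P\<close> from the points near \<open>0\<close> to all of
  \<open>Z\<close>. The essential step is that composing arcs yields the reflection of \<open>Z / 3\<^sup>n\<close> about its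
  midpoint, that is, \<open>P (c / 3\<^sup>n) \<longleftrightarrow> P ((1 - c) / 3\<^sup>n)\<close>. For \<open>n = 0\<close> this is family
  \<open>0\<close>. For the next \<open>n\<close>, the point \<open>c / 3\<^sup>n\<^sup>+\<^sup>1\<close> in the left third is reflected into the right
  third, there family \<open>n + 1\<close> reflects the right third onto itself, and a second reflection at
  level \<open>n\<close> returns to the left third. The reflection at level \<open>n\<close> exchanges the left and the
  right third of \<open>Z / 3\<^sup>n\<close>, so that \<open>P\<close> on \<open>Z / 3\<^sup>n\<^sup>+\<^sup>1\<close> extends to
  \<open>Z / 3\<^sup>n\<close>.
\<close>

lemma arc_invariant_propagates:
  fixes P :: "real \<Rightarrow> bool"
  assumes Z: "arc_invariant Z"
    and inv: "\<And>i c. c \<in> Z \<Longrightarrow> P (arc_start i c) \<longleftrightarrow> P (arc_end i c)"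
    and near0: "\<And>c. c \<in> Z \<Longrightarrow> P (c / 3 ^ m)"
    and z: "z \<in> Z"
  shows "P z"
proof -
  have third: "c / 3 \<in> Z" if "c \<in> Z" for c using arc_invariant_scale[OF Z that, of 1] by simp
  have block: "P ((2 / 3 + e / 3) / 3 ^ n) \<longleftrightarrow> P ((1 - e / 3) / 3 ^ n)" if "e \<in> Z" for e n
    using Z that
  proof (cases rule: arc_invariant_cases)
    case (1 c)
    then show ?thesis using inv[OF 1(1), of "Suc n"] unfolding 1(2) by (simp add: arc_Suc)
  next
    case (2 c)
    have eq: "2 / 3 + e / 3 = 1 - c / 9" "1 - e / 3 = 2 / 3 + c / 9"
      using 2 by (simp_all add: field_simps)
    show ?thesis using inv[OF 2(1), of "Suc n"] unfolding eq arc_Suc by blast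
  qed
  have reflect: "P (c / 3 ^ n) \<longleftrightarrow> P ((1 - c) / 3 ^ n)" if "c \<in> Z" for c n
    using that
  proof (induction n arbitrary: c)
    case 0
    from Z 0 show ?case
    proof (cases rule: arc_invariant_cases)
      case (1 b)
      then show ?thesis using inv[OF 1(1), of 0] unfolding 1(2) arc_0 by simp
    next
      case (2 b)
      then show ?thesis using inv[OF 2(1), of 0] unfolding 2(2) arc_0 by auto
    qed
  next
    case (Suc n)
    have c': "1 - (1 - c) / 3 \<in> Z"
      using arc_invariant_reflect[OF Z] third Suc.prems by blast
    have e: "1 - (1 - c) / 3 = 2 / 3 + c / 3" "1 - (2 / 3 + c / 3) = (1 - c) / 3"
      by (simp_all add: field_simps)
    have "P (c / 3 ^ Suc n) \<longleftrightarrow> P (c / 3 / 3 ^ n)" by (simp add: field_simps)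
    also have "\<dots> \<longleftrightarrow> P ((1 - c / 3) / 3 ^ n)" using Suc.IH[OF third[OF Suc.prems]] .
    also have "\<dots> \<longleftrightarrow> P ((2 / 3 + c / 3) / 3 ^ n)" using block[OF Suc.prems] by simp
    also have "\<dots> \<longleftrightarrow> P ((1 - c) / 3 / 3 ^ n)" using Suc.IH[OF c'] unfolding e .
    also have "\<dots> \<longleftrightarrow> P ((1 - c) / 3 ^ Suc n)" by (simp add: field_simps)
    finally show ?case .
  qed
  \<comment> \<open>Descent from level \<open>m\<close> to level \<open>0\<close>; the truncated difference makes the steps after level \<open>0\<close> trivial.\<close>
  have "\<forall>c\<in>Z. P (c / 3 ^ (m - k))" for k
  proof (induction k)
    case (Suc k)
    show ?case
    proof (cases "k < m")
      case True
      then have m: "m - k = Suc (m - Suc k)" by simp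
      have P: "P (c / 3 / 3 ^ (m - Suc k))" if "c \<in> Z" for c
        using Suc.IH that by (simp add: m)
      show ?thesis
      proof
        fix c assume c: "c \<in> Z"
        from Z c show "P (c / 3 ^ (m - Suc k))"
        proof (cases rule: arc_invariant_cases)
          case (1 b)
          show ?thesis unfolding 1(2) by (rule P[OF 1(1)])
        next
          case (2 b)
          then show ?thesis using P[OF 2(1)] reflect[OF third[OF 2(1)]] by simp
        qed
      qed
    qed (use Suc.IH in auto)
  qed (use near0 in auto)
  from this[of m] z show ?thesis by simp
qed

text \<open>
  The ends of the arcs are affine functions of \<open>c\<close> with rational coefficients.
\<close>

lemma arc_Rats: "arc_start i c \<in> \<rat> \<longleftrightarrow> c \<in> \<rat>" "arc_end i c \<in> \<rat> \<longleftrightarrow> c \<in> \<rat>"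
proof -
  have c: "c = (if i = 0 then 3 * arc_start i c else (arc_start i c - 2 / 3 ^ i) * 3 ^ (i + 1))"
    by (simp add: arc_start_def)
  show start: "arc_start i c \<in> \<rat> \<longleftrightarrow> c \<in> \<rat>"
  proof
    assume "arc_start i c \<in> \<rat>"
    then have "(if i = 0 then 3 * arc_start i c else (arc_start i c - 2 / 3 ^ i) * 3 ^ (i + 1)) \<in> \<rat>"
      by (cases "i = 0") auto
    then show "c \<in> \<rat>" using c by simp
  qed (simp add: arc_start_def)
  have "arc_start i c = (if i = 0 then 1 else 5 / 3 ^ i) - arc_end i c" by (simp add: arc_end_def)
  then have "arc_end i c \<in> \<rat> \<Longrightarrow> arc_start i c \<in> \<rat>" by (metis Rats_1 Rats_diff Rats_divide Rats_number_of Rats_power)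
  moreover have "arc_start i c \<in> \<rat> \<Longrightarrow> arc_end i c \<in> \<rat>" by (simp add: arc_end_def)
  ultimately show "arc_end i c \<in> \<rat> \<longleftrightarrow> c \<in> \<rat>" using start by blast
qed

lemma arc_invariant_rational: "arc_invariant (cantor_set \<inter> \<rat>)"
  unfolding arc_invariant_def using arc_Rats arc_start_in_cantor_set arc_end_in_cantor_set by auto

lemma arc_invariant_irrational: "arc_invariant (cantor_set - \<rat>)"
  unfolding arc_invariant_def using arc_Rats arc_start_in_cantor_set arc_end_in_cantor_set by auto

lemma dense_arc_invariant:
  assumes Z: "arc_invariant Z" "Z \<noteq> {}" shows "cantor_set \<subseteq> closure Z"
proof (rule dense_in_cantor_set)
  show "Z \<subseteq> {0..1}" using Z cantor_set_bounds by (auto simp: arc_invariant_def)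
  fix t assume t: "t \<in> Z"
  then show "t / 3 \<in> Z" using arc_invariant_scale[OF Z(1) t, of 1] by simp
  then have "1 - (1 - t) / 3 \<in> Z"
    using arc_invariant_reflect[OF Z(1)] arc_invariant_scale[OF Z(1), of "1 - t" 1] t by simp
  moreover have "1 - (1 - t) / 3 = 2 / 3 + t / 3" by (simp add: field_simps)
  ultimately show "2 / 3 + t / 3 \<in> Z" by simp
qed (use Z in auto)

text \<open>
  The parametrisation of the arcs by \<open>C \<times> \<real>\<close> instead of \<open>C \<times> (0, 1)\<close>, so that the space
  \<open>Y\<close> can be used in place of its image under \<open>Xi\<close>.
\<close>

definition knaster_line :: "nat \<Rightarrow> real \<times> real \<Rightarrow> real \<times> real" where
  "knaster_line i p = knaster_chart i (Xi p)"

lemma continuous_knaster_chart: "continuous_on UNIV (knaster_chart i)"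
proof -
  have "continuous_on UNIV (\<lambda>p. knaster_chart i (fst p, snd p))"
    unfolding knaster_chart_eq Let_def arc_end_def arc_start_def
    by (cases "i = 0") (auto intro!: continuous_intros)
  then show ?thesis by simp
qed

lemma continuous_knaster_line: "continuous_on UNIV (knaster_line i)"
proof -
  have "continuous_on UNIV (\<lambda>p :: real \<times> real. (fst p, arctan (snd p) / pi + 1 / 2))"
    by (auto intro!: continuous_intros)
  moreover have "Xi = (\<lambda>p. (fst p, arctan (snd p) / pi + 1 / 2))" by (auto simp: Xi_def)
  ultimately have "continuous_on UNIV Xi" by metis
  then show ?thesis
    unfolding knaster_line_def
    by (intro continuous_on_compose2[OF continuous_knaster_chart]) auto
qed

lemma Xi_bounds: "0 < arctan r / pi + 1 / 2" "arctan r / pi + 1 / 2 < 1"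
  using arctan_bounded[of r] by (auto simp: field_simps)

text \<open>
  The sum of the coordinates increases along each arc, and the arc itself is recovered from a minimum
  of the coordinates. Both together give injectivity, and the third statement keeps the arcs off
  the diagonal.
\<close>

lemma knaster_line_coordinates:
  assumes "c \<in> cantor_set"
  defines "t \<equiv> \<lambda>r. arctan r / pi + 1 / 2"
  shows "fst (knaster_line i (c, r)) + snd (knaster_line i (c, r))
      = 2 * arc_start i c + 2 * t r * (arc_end i c - arc_start i c)"
    and "arc_start i c = (if i = 0 then min (fst (knaster_line i (c, r))) (1 - snd (knaster_line i (c, r)))
      else min (snd (knaster_line i (c, r))) (5 / 3 ^ i - fst (knaster_line i (c, r))))"
    and "fst (knaster_line i (c, r)) \<noteq> snd (knaster_line i (c, r))"
proof -
  define x y where xy: "x = arc_start i c" "y = arc_end i c"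
  have less: "0 < y - x" using arc_start_less_end[OF assms(1)] by (simp add: xy)
  have t: "0 < t r" "t r < 1" using Xi_bounds by (auto simp: t_def)
  have "Xi (c, r) = (c, t r)" by (simp add: Xi_def t_def)
  then have line: "knaster_line i (c, r) =
     (let p = x + max 0 (2 * t r - 1) * (y - x); p' = x + min 1 (2 * t r) * (y - x)
      in if i = 0 then (p, p') else (p', p))"
    by (simp only: knaster_line_def knaster_chart_eq Let_def xy)
  have "max 0 (2 * t r - 1) + min 1 (2 * t r) = 2 * t r" by auto
  then have "(max 0 (2 * t r - 1) + min 1 (2 * t r)) * (y - x) = 2 * t r * (y - x)" by simp
  then show "fst (knaster_line i (c, r)) + snd (knaster_line i (c, r))
      = 2 * arc_start i c + 2 * t r * (arc_end i c - arc_start i c)"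
    unfolding line xy[symmetric] Let_def by (simp add: algebra_simps)
  have "(if i = 0 then 1 else 5 / 3 ^ i) = x + y" by (simp add: xy arc_end_def)
  moreover have "x = min (x + max 0 (2 * t r - 1) * (y - x)) (x + y - (x + min 1 (2 * t r) * (y - x)))"
  proof (cases "2 * t r \<le> 1")
    case True
    define w where "w = 2 * t r * (y - x)"
    have "(2 * t r) * (y - x) \<le> 1 * (y - x)" using True less by (intro mult_right_mono) auto
    then have w: "w \<le> y - x" by (simp add: w_def)
    have m: "max 0 (2 * t r - 1) = 0" "min 1 (2 * t r) = 2 * t r" using True by auto
    show ?thesis using w less unfolding m w_def[symmetric] by (simp add: min_def)
  next
    case False
    define w where "w = (2 * t r - 1) * (y - x)"
    have w: "0 \<le> w" unfolding w_def using False less by (intro mult_nonneg_nonneg) auto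
    have m: "max 0 (2 * t r - 1) = 2 * t r - 1" "min 1 (2 * t r) = 1" using False by auto
    show ?thesis using w less unfolding m w_def[symmetric] by (simp add: min_def)
  qed
  ultimately show "arc_start i c = (if i = 0 then min (fst (knaster_line i (c, r))) (1 - snd (knaster_line i (c, r)))
      else min (snd (knaster_line i (c, r))) (5 / 3 ^ i - fst (knaster_line i (c, r))))"
    unfolding line xy(1)[symmetric] Let_def by (auto split: if_splits)
  have "max 0 (2 * t r - 1) < min 1 (2 * t r)" using t by auto
  then show "fst (knaster_line i (c, r)) \<noteq> snd (knaster_line i (c, r))"
    unfolding line Let_def using less by auto
qed

lemma inj_on_knaster_line: "inj_on (knaster_line i) (cantor_set \<times> UNIV)"
proof (rule inj_onI)
  fix p p' :: "real \<times> real"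
  assume p: "p \<in> cantor_set \<times> UNIV" "p' \<in> cantor_set \<times> UNIV" "knaster_line i p = knaster_line i p'"
  obtain c r c' r' where pp: "p = (c, r)" "p' = (c', r')" by fastforce
  then have c: "c \<in> cantor_set" "c' \<in> cantor_set" using p by auto
  have "arc_start i c = arc_start i c'"
    using knaster_line_coordinates(2)[OF c(1), of i r] knaster_line_coordinates(2)[OF c(2), of i r']
    by (simp only: p(3)[unfolded pp])
  then have cc: "c = c'" by (auto simp: arc_start_def split: if_splits)
  have "2 * (arctan r / pi + 1 / 2) * (arc_end i c - arc_start i c)
      = 2 * (arctan r' / pi + 1 / 2) * (arc_end i c - arc_start i c)"
    using knaster_line_coordinates(1)[OF c(1), of i r] knaster_line_coordinates(1)[OF c(1), of i r']
      p(3) unfolding pp cc by (metis add_left_cancel)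
  then have "arctan r / pi = arctan r' / pi" using arc_start_less_end[OF c(1), of i] by simp
  then show "p = p'" using cc pp by (simp add: arctan_eq_iff)
qed

lemma knaster_line_tendsto:
  "((\<lambda>r. knaster_line i (c, r)) \<longlongrightarrow> (arc_start i c, arc_start i c)) at_bot"
  "((\<lambda>r. knaster_line i (c, r)) \<longlongrightarrow> (arc_end i c, arc_end i c)) at_top"
proof -
  have cont: "((\<lambda>t. knaster_chart i (c, t)) \<longlongrightarrow> knaster_chart i (c, t0)) (at t0)" for t0
  proof -
    have "continuous_on UNIV (\<lambda>t. knaster_chart i (c, t))"
      by (intro continuous_on_compose2[OF continuous_knaster_chart]) (auto intro!: continuous_intros)
    then show ?thesis by (auto simp: continuous_on_def)
  qed
  have line: "knaster_line i (c, r) = knaster_chart i (c, arctan r / pi + 1 / 2)" for r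
    by (simp add: knaster_line_def Xi_def)
  have "((\<lambda>r. arctan r / pi + 1 / 2) \<longlongrightarrow> - (pi / 2) / pi + 1 / 2) at_bot"
    by (intro tendsto_intros tendsto_arctan_at_bot) auto
  then have "filterlim (\<lambda>r. arctan r / pi + 1 / 2) (at 0) at_bot"
    using Xi_bounds by (auto simp: filterlim_at less_imp_neq[THEN not_sym] intro!: always_eventually)
  from filterlim_compose[OF cont this] show "((\<lambda>r. knaster_line i (c, r)) \<longlongrightarrow> (arc_start i c, arc_start i c)) at_bot"
    unfolding line by (simp add: knaster_chart_eq Let_def split: if_splits)
  have "((\<lambda>r. arctan r / pi + 1 / 2) \<longlongrightarrow> (pi / 2) / pi + 1 / 2) at_top"
    by (intro tendsto_intros tendsto_arctan_at_top) auto
  then have "filterlim (\<lambda>r. arctan r / pi + 1 / 2) (at 1) at_top"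
    using Xi_bounds by (auto simp: filterlim_at less_imp_neq intro!: always_eventually)
  from filterlim_compose[OF cont this] show "((\<lambda>r. knaster_line i (c, r)) \<longlongrightarrow> (arc_end i c, arc_end i c)) at_top"
    unfolding line by (simp add: knaster_chart_eq Let_def split: if_splits)
qed

definition knaster_part :: "real set \<Rightarrow> (nat \<Rightarrow> (real \<times> real) set) \<Rightarrow> (real \<times> real) set" where
  "knaster_part Z A = (\<lambda>x. (x, x)) ` Z \<union> (\<Union>i. knaster_line i ` A i)"

section \<open>The jump function and the space it cuts out\<close>

locale cantor_jumps =
  fixes d a q :: "nat \<Rightarrow> real"
  assumes inj_d: "inj d"
    and d_nonendpoint: "range d \<subseteq> cantor_nonendpoints"
    and d_dense: "cantor_set \<subseteq> closure (range d)"
    and a_pos: "\<And>n. 0 < a n"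
    and a_sums: "a sums 1"
begin

abbreviation f :: "real \<Rightarrow> real" where "f \<equiv> jump_fun d a"

text \<open>
  The right limit of \<open>f\<close>; the function \<open>f\<close> itself is left-continuous.
\<close>

definition f_right :: "real \<Rightarrow> real" where
  "f_right c = (\<Sum>\<^sub>\<infinity>n\<in>{n. d n \<le> c}. a n)"

lemma a_summable_on: "a summable_on T"
proof -
  have "a summable_on UNIV"
    using a_sums a_pos by (auto simp: summable_on_UNIV_nonneg_real_iff less_imp_le sums_iff)
  then show ?thesis using summable_on_subset_banach by blast
qed

lemma infsum_a_mono: "T \<subseteq> T' \<Longrightarrow> infsum a T \<le> infsum a T'"
  using a_pos by (intro infsum_mono2 a_summable_on) (auto simp: less_imp_le)

lemma infsum_a_Un_le: "infsum a (T \<union> T') \<le> infsum a T + infsum a T'"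
proof -
  have "infsum a (T \<union> T') = infsum a T + infsum a (T' - T)"
    using infsum_Un_disjoint[of a T "T' - T"] a_summable_on by auto
  also have "\<dots> \<le> infsum a T + infsum a T'"
    using infsum_a_mono[of "T' - T" T'] by auto
  finally show ?thesis .
qed

text \<open>
  Small tails of the series are what controls \<open>f\<close> near a point: only finitely many jumps are not
  in the tail, and a small one-sided neighbourhood avoids all of these.
\<close>

lemma infsum_a_tail:
  assumes "0 < e" obtains N where "infsum a {N..} < e"
proof -
  have "(\<lambda>N. \<Sum>n<N. a n) \<longlonglongrightarrow> 1" using a_sums by (simp add: sums_def)
  then obtain N where N: "\<bar>(\<Sum>n<N. a n) - 1\<bar> < e"
    using assms by (metis LIMSEQ_iff order_refl real_norm_def)
  have "a sums infsum a UNIV"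
    using has_sum_imp_sums a_summable_on has_sum_infsum by blast
  then have "infsum a UNIV = 1" using a_sums sums_unique2 by blast
  moreover have "infsum a UNIV = infsum a {..<N} + infsum a {N..}"
  proof -
    have "UNIV = {..<N} \<union> {N..}" "{..<N} \<inter> {N..} = {}" by auto
    then show ?thesis using infsum_Un_disjoint[of a "{..<N}" "{N..}"] a_summable_on by metis
  qed
  ultimately show ?thesis using N that[of N] by simp
qed

lemma f_left:
  assumes "0 < e"
  obtains \<delta> where "0 < \<delta>" "\<And>c'. c - \<delta> < c' \<Longrightarrow> c' \<le> c \<Longrightarrow> \<bar>f c' - f c\<bar> < e"
proof -
  obtain N where N: "infsum a {N..} < e" using infsum_a_tail[OF assms] .
  define \<delta> where "\<delta> = Min (insert 1 ((\<lambda>n. c - d n) ` {n. n < N \<and> d n < c}))"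
  have "0 < \<delta>" by (auto simp: \<delta>_def)
  moreover have "\<bar>f c' - f c\<bar> < e" if c': "c - \<delta> < c'" "c' \<le> c" for c'
  proof -
    have "d n < c'" if "d n < c" "n < N" for n
    proof -
      have "\<delta> \<le> c - d n" unfolding \<delta>_def using that by (intro Min_le) auto
      then show ?thesis using c' by simp
    qed
    then have "{n. d n < c} \<subseteq> {n. d n < c'} \<union> {N..}" by (auto simp: not_less)
    then have "f c \<le> f c' + infsum a {N..}"
      unfolding jump_fun_def using infsum_a_mono infsum_a_Un_le order_trans by blast
    moreover have "f c' \<le> f c" unfolding jump_fun_def using c' by (intro infsum_a_mono) auto
    ultimately show ?thesis using N by simp
  qed
  ultimately show ?thesis using that by blast
qed

lemma f_right_limit:
  assumes "0 < e"
  obtains \<delta> where "0 < \<delta>" "\<And>c'. c < c' \<Longrightarrow> c' < c + \<delta> \<Longrightarrow> \<bar>f c' - f_right c\<bar> < e"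
proof -
  obtain N where N: "infsum a {N..} < e" using infsum_a_tail[OF assms] .
  define \<delta> where "\<delta> = Min (insert 1 ((\<lambda>n. d n - c) ` {n. n < N \<and> c < d n}))"
  have "0 < \<delta>" by (auto simp: \<delta>_def)
  moreover have "\<bar>f c' - f_right c\<bar> < e" if c': "c < c'" "c' < c + \<delta>" for c'
  proof -
    have "d n \<le> c" if "d n < c'" "n < N" for n
    proof (rule ccontr)
      assume "\<not> d n \<le> c"
      then have "\<delta> \<le> d n - c" unfolding \<delta>_def using that by (intro Min_le) auto
      then show False using c' that by simp
    qed
    then have "{n. d n < c'} \<subseteq> {n. d n \<le> c} \<union> {N..}" by (auto simp: not_less)
    then have "f c' \<le> f_right c + infsum a {N..}"
      unfolding jump_fun_def f_right_def using infsum_a_mono infsum_a_Un_le order_trans by blast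
    moreover have "f_right c \<le> f c'" unfolding jump_fun_def f_right_def
      using c' by (intro infsum_a_mono) auto
    ultimately show ?thesis using N by simp
  qed
  ultimately show ?thesis using that by blast
qed

lemma f_right_eq: "c \<notin> range d \<Longrightarrow> f_right c = f c"
  unfolding f_right_def jump_fun_def by (rule arg_cong[where f = "infsum a"]) (auto simp: order_le_less)

lemma f_right_jump: "f_right (d k) = f (d k) + a k"
proof -
  have "{n. d n \<le> d k} = {n. d n < d k} \<union> {k}"
    using inj_d by (auto simp: order_le_less inj_eq)
  then show ?thesis
    unfolding f_right_def jump_fun_def
    using infsum_Un_disjoint[of a "{n. d n < d k}" "{k}"] a_summable_on by simp
qed

definition graph_closure :: "nat \<Rightarrow> (real \<times> real) set" where
  "graph_closure n = top_of_set (cantor_set \<times> UNIV) closure_of cantor_graph (\<lambda>c. f c + q n)"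

lemma Y_space_eq: "Y_space d a q = cantor_set \<times> UNIV - (\<Union>n. graph_closure n)"
  by (simp add: Y_space_def graph_closure_def)

lemma closed_graph_closure: "closed (graph_closure n)"
proof -
  have "closedin (top_of_set (cantor_set \<times> (UNIV :: real set))) (graph_closure n)"
    by (simp add: graph_closure_def)
  then show ?thesis
    using closedin_closed_trans closed_Times closed_cantor_set closed_UNIV by blast
qed

text \<open>
  Over \<open>c\<close> the closure of the graph can only contain one-sided limits.
\<close>

lemma graph_closure_fibre:
  assumes "(c, r) \<in> graph_closure n" shows "r = f c + q n \<or> r = f_right c + q n"
proof (rule ccontr)
  assume neg: "\<not> ?thesis"
  define e where "e = min \<bar>r - (f c + q n)\<bar> \<bar>r - (f_right c + q n)\<bar> / 2"
  have e: "0 < e" using neg by (auto simp: e_def)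
  have e_le: "2 * e \<le> \<bar>r - (f c + q n)\<bar>" "2 * e \<le> \<bar>r - (f_right c + q n)\<bar>"
    by (auto simp: e_def)
  obtain \<delta>1 where d1: "0 < \<delta>1" "\<And>c'. c - \<delta>1 < c' \<Longrightarrow> c' \<le> c \<Longrightarrow> \<bar>f c' - f c\<bar> < e"
    using f_left[OF e, of c] by blast
  obtain \<delta>2 where d2: "0 < \<delta>2" "\<And>c'. c < c' \<Longrightarrow> c' < c + \<delta>2 \<Longrightarrow> \<bar>f c' - f_right c\<bar> < e"
    using f_right_limit[OF e, of c] by blast
  let ?N = "{c - \<delta>1<..<c + \<delta>2} \<times> {r - e<..<r + e}"
  have "(c, r) \<in> closure (cantor_graph (\<lambda>c. f c + q n))"
    using assms closure_of_subtopology_subset[of euclidean "cantor_set \<times> UNIV"]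
    unfolding graph_closure_def by auto
  moreover have "open ?N" "(c, r) \<in> ?N" using d1 d2 e by (auto intro: open_Times)
  ultimately have "?N \<inter> cantor_graph (\<lambda>c. f c + q n) \<noteq> {}"
    using open_Int_closure_eq_empty by blast
  then obtain c' where c': "c - \<delta>1 < c'" "c' < c + \<delta>2"
      and close: "r - e < f c' + q n" "f c' + q n < r + e"
    by (auto simp: cantor_graph_def)
  show False
  proof (cases "c' \<le> c")
    case True
    then have "\<bar>f c' - f c\<bar> < e" using d1 c' by auto
    then show False using close e_le by linarith
  next
    case False
    then have "\<bar>f c' - f_right c\<bar> < e" using d2 c' by auto
    then show False using close e_le by linarith
  qed
qed

lemma Y_fst: "p \<in> Y_space d a q \<Longrightarrow> fst p \<in> cantor_set"
  by (auto simp: Y_space_eq)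

lemma Y_fibre_complement:
  assumes "c \<in> cantor_set" "(c, r) \<notin> Y_space d a q"
  obtains n where "r = f c + q n \<or> r = f_right c + q n"
  using assms graph_closure_fibre by (auto simp: Y_space_eq)

lemma countable_Y_fibre_complement:
  assumes "c \<in> cantor_set" shows "countable {r. (c, r) \<notin> Y_space d a q}"
proof (rule countable_subset)
  show "{r. (c, r) \<notin> Y_space d a q} \<subseteq> range (\<lambda>n. f c + q n) \<union> range (\<lambda>n. f_right c + q n)"
    using Y_fibre_complement[OF assms] by blast
qed auto

lemma gdelta_closed_Int_Y:
  assumes "closed F" shows "gdelta_in euclidean (F \<inter> Y_space d a q)"
proof -
  have "closed (F \<inter> cantor_set \<times> UNIV)"
    using assms closed_cantor_set by (intro closed_Int closed_Times) auto
  then have "gdelta_in euclidean (F \<inter> cantor_set \<times> UNIV)"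
    using closed_imp_gdelta_in[OF metrizable_space_euclidean] by simp
  moreover have "fsigma_in euclidean (\<Union>n. graph_closure n)"
    using closed_graph_closure by (intro fsigma_in_Union) (auto intro!: closed_imp_fsigma_in)
  ultimately have "gdelta_in euclidean (F \<inter> cantor_set \<times> UNIV - (\<Union>n. graph_closure n))"
    by (rule gdelta_in_diff)
  then show ?thesis by (simp add: Y_space_eq Int_Diff)
qed

lemma uncountable_vertical_Y:
  assumes "c \<in> cantor_set" "x < y"
  shows "uncountable ({c} \<times> {x<..<y} \<inter> Y_space d a q)"
proof -
  have "uncountable ({x<..<y} - {r. (c, r) \<notin> Y_space d a q})"
    using countable_Y_fibre_complement[OF assms(1)] assms(2)
    by (intro uncountable_minus_countable) (auto simp: uncountable_open_interval)
  then have "uncountable (Pair c ` ({x<..<y} - {r. (c, r) \<notin> Y_space d a q}))"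
    using countable_image_inj_on[of "Pair c"] by (auto simp: inj_on_def)
  moreover have "Pair c ` ({x<..<y} - {r. (c, r) \<notin> Y_space d a q}) \<subseteq> {c} \<times> {x<..<y} \<inter> Y_space d a q"
    by auto
  ultimately show ?thesis using countable_subset by metis
qed

text \<open>
  Infinitely many \<open>d\<^sub>k\<close> lie in the open set, and the jumps tend to \<open>0\<close>.
\<close>

lemma small_jump_in_open:
  assumes "open J" "x \<in> cantor_set" "x \<in> J" "0 < e"
  obtains k where "d k \<in> J" "a k < e"
proof -
  have "a \<longlonglongrightarrow> 0" using a_sums summable_LIMSEQ_zero sums_summable by blast
  then obtain N where N: "\<And>n. N \<le> n \<Longrightarrow> a n < e"
    using assms(4) by (metis LIMSEQ_D abs_less_iff diff_zero real_norm_def)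
  have "uncountable (cantor_set \<inter> J)"
    using uncountable_cantor_set_Int_open assms by blast
  then have "\<not> cantor_set \<inter> J \<subseteq> d ` {..<N}"
    using countable_subset[of _ "d ` {..<N}"] by auto
  then obtain y where y: "y \<in> cantor_set" "y \<in> J - d ` {..<N}" by blast
  have "open (J - d ` {..<N})" using assms(1) by (intro open_Diff finite_imp_closed) auto
  then have "(J - d ` {..<N}) \<inter> range d \<noteq> {}"
    using y d_dense open_Int_closure_eq_empty by blast
  then obtain k where k: "d k \<in> J" "d k \<notin> d ` {..<N}" by blast
  then have "N \<le> k" by (auto simp: not_less[symmetric])
  then show ?thesis using that[of k] N k by blast
qed

section \<open>Open sets do not split the fibres of a Bernstein part\<close>

text \<open>
  The points \<open>c\<close> over which, within distance \<open>e\<close> of \<open>f(c) + p\<close>, the set \<open>U\<close> has nothing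
  below and \<open>V\<close> nothing above.
\<close>

definition one_sided :: "(real \<times> real) set \<Rightarrow> (real \<times> real) set \<Rightarrow> real \<Rightarrow> real \<Rightarrow> real set" where
  "one_sided U V p e = {c \<in> cantor_set.
     {c} \<times> {f c + p - e<..<f c + p} \<inter> U = {} \<and> {c} \<times> {f c + p<..<f c + p + e} \<inter> V = {}}"

text \<open>
  If the set were dense near some \<open>d\<^sub>k\<close> with a jump smaller than \<open>e\<close>, a limit from the left
  would show that \<open>V\<close> contains no point of the jump interval over \<open>d\<^sub>k\<close>, and a limit from the
  right that \<open>U\<close> contains none. That interval has uncountably many points in \<open>Y\<close>. Such
  \<open>d\<^sub>k\<close> occur in every open part of the Cantor set, and as they are not endpoints they can be
  approached from both sides.
\<close>

lemma one_sided_nowhere_dense: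
  assumes U: "open U" and V: "open V" and cnt: "countable (- (U \<union> V) \<inter> Y_space d a q)"
    and e: "0 < e" and J: "open J" "x \<in> cantor_set" "x \<in> J"
  shows "\<not> cantor_set \<inter> J \<subseteq> closure (one_sided U V p e)"
proof
  assume sub: "cantor_set \<inter> J \<subseteq> closure (one_sided U V p e)"
  obtain k where k: "d k \<in> J" "a k < e" using small_jump_in_open[OF J e] .
  let ?x = "d k" and ?T = "one_sided U V p e"
  have dk: "?x \<in> cantor_nonendpoints" using d_nonendpoint by auto
  then have xC: "?x \<in> cantor_set" by (simp add: cantor_nonendpoints_def)
  obtain \<eta>0 where \<eta>0: "0 < \<eta>0" "ball ?x \<eta>0 \<subseteq> J"
    using J(1) k(1) open_contains_ball by blast
  have near: "\<exists>c\<in>?T. ?x - \<eta> < c \<and> c < ?x" "\<exists>c\<in>?T. ?x < c \<and> c < ?x + \<eta>" if "0 < \<eta>" for \<eta>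
  proof -
    obtain u v where uv: "u \<in> cantor_set" "v \<in> cantor_set"
      "?x - min \<eta> \<eta>0 < u" "u < ?x" "?x < v" "v < ?x + min \<eta> \<eta>0"
      using cantor_nonendpoint_two_sided[OF dk, of "min \<eta> \<eta>0"] \<eta>0(1) \<open>0 < \<eta>\<close> by auto
    then have "u \<in> J" "v \<in> J" using \<eta>0(2) by (auto simp: subset_iff dist_real_def)
    then have "u \<in> closure ?T" "v \<in> closure ?T" using sub uv by auto
    moreover have "u \<in> {?x - \<eta><..<?x}" "v \<in> {?x<..<?x + \<eta>}" using uv by auto
    ultimately have "{?x - \<eta><..<?x} \<inter> ?T \<noteq> {}" "{?x<..<?x + \<eta>} \<inter> ?T \<noteq> {}"
      using open_Int_closure_eq_empty open_greaterThanLessThan by blast+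
    then show "\<exists>c\<in>?T. ?x - \<eta> < c \<and> c < ?x" "\<exists>c\<in>?T. ?x < c \<and> c < ?x + \<eta>" by auto
  qed
  have box: "\<exists>\<eta>>0. \<forall>c. \<bar>c - ?x\<bar> < \<eta> \<longrightarrow> (c, t) \<in> S" if S: "open S" "(?x, t) \<in> S" for S t
  proof -
    obtain A B where "open A" "open B" "(?x, t) \<in> A \<times> B" "A \<times> B \<subseteq> S"
      using S by (rule open_prod_elim)
    moreover from this have "?x \<in> A" by simp
    moreover obtain \<eta> where "0 < \<eta>" "ball ?x \<eta> \<subseteq> A"
      using \<open>open A\<close> \<open>?x \<in> A\<close> open_contains_ball by blast
    ultimately show ?thesis by (intro exI[of _ \<eta>]) (auto simp: subset_iff dist_real_def abs_minus_commute)
  qed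
  have gap: "(?x, t) \<in> - (U \<union> V)" if t: "f ?x + p < t" "t < f ?x + p + a k" for t
  proof -
    have "(?x, t) \<notin> V"
    proof
      assume "(?x, t) \<in> V"
      then obtain \<eta> where \<eta>: "0 < \<eta>" "\<And>c. \<bar>c - ?x\<bar> < \<eta> \<Longrightarrow> (c, t) \<in> V" using box[OF V] by blast
      \<comment> \<open>With \<open>f c\<close> this close to \<open>f ?x\<close>, the height \<open>t\<close> is still above \<open>f c + p\<close> by less than \<open>e\<close>.\<close>
      define e' where "e' = min (t - (f ?x + p)) (e - (t - (f ?x + p)))"
      have "0 < e'" using t k(2) by (auto simp: e'_def)
      then obtain \<delta> where \<delta>: "0 < \<delta>" "\<And>c. ?x - \<delta> < c \<Longrightarrow> c \<le> ?x \<Longrightarrow> \<bar>f c - f ?x\<bar> < e'"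
        using f_left[of e' ?x] by blast
      obtain c where c: "c \<in> ?T" "?x - min \<eta> \<delta> < c" "c < ?x"
        using near(1)[of "min \<eta> \<delta>"] \<eta>(1) \<delta>(1) by auto
      have "\<bar>f c - f ?x\<bar> < e'" using \<delta>(2)[of c] c by auto
      then have "t \<in> {f c + p<..<f c + p + e}" by (auto simp: e'_def abs_less_iff)
      moreover have "(c, t) \<in> V" using \<eta>(2)[of c] c by auto
      ultimately show False using c(1) unfolding one_sided_def by blast
    qed
    moreover have "(?x, t) \<notin> U"
    proof
      assume "(?x, t) \<in> U"
      then obtain \<eta> where \<eta>: "0 < \<eta>" "\<And>c. \<bar>c - ?x\<bar> < \<eta> \<Longrightarrow> (c, t) \<in> U" using box[OF U] by blast
      define s where "s = f_right ?x + p"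
      have s: "s = f ?x + p + a k" by (simp add: s_def f_right_jump)
      \<comment> \<open>With \<open>f c\<close> this close to \<open>f_right ?x\<close>, the height \<open>t\<close> is still below \<open>f c + p\<close> by less than \<open>e\<close>.\<close>
      define e' where "e' = min (s - t) (e - (s - t))"
      have "0 < e'" using t k(2) s by (auto simp: e'_def)
      then obtain \<delta> where \<delta>: "0 < \<delta>" "\<And>c. ?x < c \<Longrightarrow> c < ?x + \<delta> \<Longrightarrow> \<bar>f c - f_right ?x\<bar> < e'"
        using f_right_limit[of e' ?x] by blast
      obtain c where c: "c \<in> ?T" "?x < c" "c < ?x + min \<eta> \<delta>"
        using near(2)[of "min \<eta> \<delta>"] \<eta>(1) \<delta>(1) by auto
      have "\<bar>f c - f_right ?x\<bar> < e'" using \<delta>(2)[of c] c by auto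
      then have "t \<in> {f c + p - e<..<f c + p}" by (auto simp: e'_def s_def abs_less_iff)
      moreover have "(c, t) \<in> U" using \<eta>(2)[of c] c by auto
      ultimately show False using c(1) unfolding one_sided_def by blast
    qed
    ultimately show ?thesis by blast
  qed
  then have "{?x} \<times> {f ?x + p<..<f ?x + p + a k} \<inter> Y_space d a q \<subseteq> - (U \<union> V) \<inter> Y_space d a q"
    by auto
  moreover have "uncountable ({?x} \<times> {f ?x + p<..<f ?x + p + a k} \<inter> Y_space d a q)"
    using uncountable_vertical_Y[OF xC] a_pos[of k] by simp
  ultimately show False using cnt countable_subset by metis
qed

lemma bernstein_part_dense_in_fibre:
  assumes bern: "\<And>F. closed F \<Longrightarrow> uncountable (F \<inter> Y_space d a q) \<Longrightarrow> F \<inter> A \<noteq> {}"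
    and "c \<in> cantor_set" "x < y"
  shows "\<exists>t. x < t \<and> t < y \<and> (c, t) \<in> A"
proof -
  obtain x' y' where xy: "x < x'" "x' < y'" "y' < y" using \<open>x < y\<close> dense by metis
  have "{c} \<times> {x'<..<y'} \<inter> Y_space d a q \<subseteq> {c} \<times> {x'..y'} \<inter> Y_space d a q" by auto
  then have "uncountable ({c} \<times> {x'..y'} \<inter> Y_space d a q)"
    using uncountable_vertical_Y[OF assms(2) xy(2)] countable_subset by metis
  then have "{c} \<times> {x'..y'} \<inter> A \<noteq> {}"
    by (intro bern closed_Times) auto
  then show ?thesis using xy by force
qed

text \<open>
  The category argument that carries the proof: isolated boundary points over nearby fibres,
  together with the theorem of Baire, contradict \<open>one_sided_nowhere_dense\<close>.
\<close>

lemma fibre_not_split: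
  assumes A: "A \<subseteq> Y_space d a q"
    and bern: "\<And>F. closed F \<Longrightarrow> uncountable (F \<inter> Y_space d a q) \<Longrightarrow> F \<inter> A \<noteq> {}"
    and U: "open U" and V: "open V" and cover: "A \<subseteq> U \<union> V" and disj: "A \<inter> U \<inter> V = {}"
    and r: "(c, r) \<in> A \<inter> U" and s: "(c, s) \<in> A \<inter> V"
  shows False
proof -
  have cC: "c \<in> cantor_set" using r A Y_fst by force
  \<comment> \<open>Disjointness on \<open>A\<close> extends to all of \<open>C \<times> \<real>\<close> because \<open>A\<close> is dense in every fibre.\<close>
  have UV: "(x, t) \<notin> U \<inter> V" if x: "x \<in> cantor_set" for x t
  proof
    assume "(x, t) \<in> U \<inter> V"
    moreover have "open (U \<inter> V)" using U V by auto
    ultimately obtain G H where "open H" "x \<in> G" "t \<in> H" "G \<times> H \<subseteq> U \<inter> V"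
      by (auto elim!: open_prod_elim)
    moreover obtain \<eta> where "0 < \<eta>" "ball t \<eta> \<subseteq> H"
      using \<open>open H\<close> \<open>t \<in> H\<close> open_contains_ball by blast
    moreover obtain t' where "t - \<eta> < t'" "t' < t + \<eta>" "(x, t') \<in> A"
      using bernstein_part_dense_in_fibre[OF bern x, of "t - \<eta>" "t + \<eta>"] \<open>0 < \<eta>\<close> by auto
    ultimately have "(x, t') \<in> A \<inter> U \<inter> V"
      by (auto simp: subset_iff dist_real_def abs_less_iff)
    then show False using disj by blast
  qed
  have cnt: "countable (- (U \<union> V) \<inter> Y_space d a q)"
  proof (rule ccontr)
    assume "uncountable (- (U \<union> V) \<inter> Y_space d a q)"
    then have "- (U \<union> V) \<inter> A \<noteq> {}" using U V by (intro bern) auto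
    then show False using cover by blast
  qed
  define N where "N = {x. (x, r) \<in> U} \<inter> {x. (x, s) \<in> V}"
  have slice: "open {x. (x, t) \<in> S}" if "open S" for S :: "(real \<times> real) set" and t
  proof -
    have "open ((\<lambda>x. (x, t)) -` S)" using that by (intro open_vimage) (auto intro: continuous_intros)
    then show ?thesis by (simp add: vimage_def)
  qed
  have vslice: "open {t. (x, t) \<in> S}" if "open S" for S :: "(real \<times> real) set" and x
  proof -
    have "open ((\<lambda>t. (x, t)) -` S)" using that by (intro open_vimage) (auto intro: continuous_intros)
    then show ?thesis by (simp add: vimage_def)
  qed
  have N: "open N" "c \<in> N" using slice U V r s by (auto simp: N_def)
  \<comment> \<open>Over the other points the complement of \<open>U \<union> V\<close> contains only heights \<open>f c + q n\<close>.\<close>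
  define X where "X = fst ` (- (U \<union> V) \<inter> Y_space d a q) \<union> range d"
  have X: "countable X" using cnt by (auto simp: X_def)
  \<comment> \<open>The index \<open>(n, m, b)\<close> records the rational, the radius and the orientation.\<close>
  define T where "T = (\<lambda>(n, m, b). if b then one_sided U V (q n) (1 / real (Suc m))
      else one_sided V U (q n) (1 / real (Suc m)))"
  have covered: "\<exists>z. x \<in> T z" if x: "x \<in> cantor_set" "x \<in> N" "x \<notin> X" for x
  proof -
    let ?u = "{t. (x, t) \<in> U}" and ?v = "{t. (x, t) \<in> V}"
    have "- (?u \<union> ?v) \<subseteq> {t. (x, t) \<notin> Y_space d a q}"
      using x(3) by (force simp: X_def)
    then have "countable (- (?u \<union> ?v))"
      using countable_Y_fibre_complement[OF x(1)] countable_subset by blast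
    moreover have "?u \<inter> ?v = {}" using UV[OF x(1)] by auto
    moreover have "?u \<noteq> {}" "?v \<noteq> {}" using x(2) by (auto simp: N_def)
    ultimately obtain p e where p: "p \<notin> ?u \<union> ?v" and e: "0 < e"
      and sides: "{p - e<..<p} \<inter> ?u = {} \<and> {p<..<p + e} \<inter> ?v = {} \<or>
        {p - e<..<p} \<inter> ?v = {} \<and> {p<..<p + e} \<inter> ?u = {}"
      using isolated_common_boundary_point[of ?u ?v] vslice U V by metis
    have "(x, p) \<notin> Y_space d a q" using p x(3) by (force simp: X_def)
    then obtain n where "p = f x + q n \<or> p = f_right x + q n" using Y_fibre_complement x(1) by metis
    moreover have "f_right x = f x" using x(3) f_right_eq by (simp add: X_def)
    ultimately have n: "p = f x + q n" by simp
    obtain m where m: "1 / real (Suc m) < e" using e nat_approx_posE by blast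
    then have "{p - 1 / real (Suc m)<..<p} \<subseteq> {p - e<..<p}" "{p<..<p + 1 / real (Suc m)} \<subseteq> {p<..<p + e}"
      by auto
    then have "{p - 1 / real (Suc m)<..<p} \<inter> ?u = {} \<and> {p<..<p + 1 / real (Suc m)} \<inter> ?v = {} \<or>
        {p - 1 / real (Suc m)<..<p} \<inter> ?v = {} \<and> {p<..<p + 1 / real (Suc m)} \<inter> ?u = {}"
      using sides by blast
    then have "x \<in> T (n, m, True) \<or> x \<in> T (n, m, False)"
    proof
      assume "{p - 1 / real (Suc m)<..<p} \<inter> ?u = {} \<and> {p<..<p + 1 / real (Suc m)} \<inter> ?v = {}"
      then have "x \<in> one_sided U V (q n) (1 / real (Suc m))"
        unfolding one_sided_def n using x(1) by blast
      then show ?thesis by (simp add: T_def)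
    next
      assume "{p - 1 / real (Suc m)<..<p} \<inter> ?v = {} \<and> {p<..<p + 1 / real (Suc m)} \<inter> ?u = {}"
      then have "x \<in> one_sided V U (q n) (1 / real (Suc m))"
        unfolding one_sided_def n using x(1) by blast
      then show ?thesis by (simp add: T_def)
    qed
    then show ?thesis by blast
  qed
  define \<G> where "\<G> = range (\<lambda>z. cantor_set - closure (T z)) \<union> (\<lambda>x. cantor_set - {x}) ` X"
  have "\<not> (\<forall>G\<in>\<G>. cantor_set \<subseteq> closure G)"
  proof
    assume dense: "\<forall>G\<in>\<G>. cantor_set \<subseteq> closure G"
    have "openin (top_of_set cantor_set) G" if "G \<in> \<G>" for G
    proof -
      have "openin (top_of_set cantor_set) (cantor_set - K)" if "closed K" for K
        using that openin_open_Int[of "- K" cantor_set] by (simp add: Diff_eq open_Compl)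
      then show ?thesis using that by (auto simp: \<G>_def)
    qed
    moreover have "countable \<G>" using X by (auto simp: \<G>_def)
    ultimately have "cantor_set \<subseteq> closure (\<Inter>\<G>)"
      using Baire[OF closed_cantor_set, of \<G>] dense by blast
    then have "N \<inter> \<Inter>\<G> \<noteq> {}" using N cC open_Int_closure_eq_empty by blast
    then obtain x where x: "x \<in> N" "x \<in> \<Inter>\<G>" by blast
    have nT: "x \<in> cantor_set - closure (T z)" for z using x(2) unfolding \<G>_def by blast
    have "x \<notin> X" using x(2) unfolding \<G>_def by blast
    then obtain z where "x \<in> T z" using covered[of x] x(1) nT by blast
    then show False using nT[of z] closure_subset by blast
  qed
  then obtain G where G: "G \<in> \<G>" "\<not> cantor_set \<subseteq> closure G" by blast
  have "cantor_set \<subseteq> closure (cantor_set - {x})" for x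
  proof
    fix y assume "y \<in> cantor_set"
    then have "y islimpt insert x (cantor_set - {x})"
      using cantor_set_islimpt islimpt_subset[of y cantor_set "insert x (cantor_set - {x})"] by blast
    then have "y islimpt cantor_set - {x}" by (rule iffD1[OF islimpt_insert])
    then show "y \<in> closure (cantor_set - {x})" by (simp add: closure_def)
  qed
  then obtain z where z: "G = cantor_set - closure (T z)" using G unfolding \<G>_def by blast
  obtain x where x: "x \<in> cantor_set" "x \<notin> closure G" using G(2) by blast
  have sub: "cantor_set \<inter> - closure G \<subseteq> closure (T z)" using z closure_subset[of G] by blast
  obtain n m b where "z = (n, m, b)" by (cases z)
  then show False
    using sub one_sided_nowhere_dense[OF U V cnt, of "1 / real (Suc m)" "- closure G" x "q n"]
      one_sided_nowhere_dense[OF V U, of "1 / real (Suc m)" "- closure G" x "q n"] cnt x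
    by (cases b) (auto simp: T_def Un_commute)
qed

section \<open>Connected parts and the decomposition\<close>

text \<open>
  If the part is separated by \<open>U\<close> and \<open>V\<close>, each arc lies on one side, and the side is passed on
  from arc to arc at the points of \<open>Z\<close>. Locally constant sides make the arcs of family
  \<open>0\<close> near \<open>c = 0\<close> agree, which starts the propagation.
\<close>

lemma knaster_part_one_sided:
  assumes Z: "arc_invariant Z" "Z \<noteq> {}"
    and A: "\<And>i. A i \<subseteq> Y_space d a q"
    and bern: "\<And>i F. closed F \<Longrightarrow> uncountable (F \<inter> Y_space d a q) \<Longrightarrow> F \<inter> A i \<noteq> {}"
    and U: "open U" and V: "open V"
    and cover: "knaster_part Z A \<subseteq> U \<union> V" and disj: "U \<inter> V \<inter> knaster_part Z A = {}"
    and r0: "(0, r0) \<in> A 0" "knaster_line 0 (0, r0) \<in> U"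
  shows "knaster_part Z A \<subseteq> U"
proof -
  have line_in: "knaster_line i p \<in> knaster_part Z A" if "p \<in> A i" for i p
    using that by (auto simp: knaster_part_def)
  have diag_in: "(z, z) \<in> knaster_part Z A" if "z \<in> Z" for z
    using that by (auto simp: knaster_part_def)
  have not_split: False
    if "(c, r) \<in> A i" "knaster_line i (c, r) \<in> U" "(c, s) \<in> A i" "knaster_line i (c, s) \<in> V" for i c r s
  proof (rule fibre_not_split)
    show "A i \<subseteq> Y_space d a q" by (rule A)
    show "F \<inter> A i \<noteq> {}" if "closed F" "uncountable (F \<inter> Y_space d a q)" for F
      using bern that by blast
    show "open (knaster_line i -` U)" "open (knaster_line i -` V)"
      using U V continuous_knaster_line by (auto intro: open_vimage)
    show "A i \<subseteq> knaster_line i -` U \<union> knaster_line i -` V" using line_in cover by blast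
    show "A i \<inter> knaster_line i -` U \<inter> knaster_line i -` V = {}" using line_in disj by blast
    show "(c, r) \<in> A i \<inter> knaster_line i -` U" "(c, s) \<in> A i \<inter> knaster_line i -` V"
      using that by auto
  qed
  define inU where "inU i c \<longleftrightarrow> (\<forall>r. (c, r) \<in> A i \<longrightarrow> knaster_line i (c, r) \<in> U)" for i c
  have inUI: "inU i c" if "(c, r) \<in> A i" "knaster_line i (c, r) \<in> U" for i c r
    unfolding inU_def using not_split that line_in cover by blast
  have inU_V: "knaster_line i (c, r) \<notin> V" if "inU i c" "(c, r) \<in> A i" for i c r
    using that line_in disj unfolding inU_def by blast
  have exists: "\<exists>t. x < t \<and> t < y \<and> (c, t) \<in> A i" if "c \<in> cantor_set" "x < y" for c x y i
    by (rule bernstein_part_dense_in_fibre[OF bern that])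
  have spread: "\<exists>\<delta>>0. \<forall>c'\<in>cantor_set. \<bar>c' - c\<bar> < \<delta> \<longrightarrow> (\<exists>t. (c', t) \<in> A i \<and> knaster_line i (c', t) \<in> S)"
    if S: "open S" and r: "knaster_line i (c, r) \<in> S" for i c r S
  proof -
    have "open (knaster_line i -` S)" "(c, r) \<in> knaster_line i -` S"
      using S r continuous_knaster_line by (auto intro: open_vimage)
    then obtain G H where GH: "open G" "open H" "(c, r) \<in> G \<times> H" "G \<times> H \<subseteq> knaster_line i -` S"
      by (rule open_prod_elim)
    obtain \<delta> where \<delta>: "0 < \<delta>" "ball c \<delta> \<subseteq> G" using GH open_contains_ball by blast
    obtain \<eta> where \<eta>: "0 < \<eta>" "ball r \<eta> \<subseteq> H" using GH open_contains_ball by blast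
    have "\<exists>t. (c', t) \<in> A i \<and> knaster_line i (c', t) \<in> S"
      if c': "c' \<in> cantor_set" "\<bar>c' - c\<bar> < \<delta>" for c'
    proof -
      obtain t where t: "r - \<eta> < t" "t < r + \<eta>" "(c', t) \<in> A i"
        using exists[OF c'(1), of "r - \<eta>" "r + \<eta>"] \<eta>(1) by auto
      have "c' \<in> ball c \<delta>" "t \<in> ball r \<eta>"
        using c'(2) t by (auto simp: dist_real_def)
      then have "(c', t) \<in> G \<times> H" using \<delta>(2) \<eta>(2) by blast
      then show ?thesis using GH(4) t(3) by blast
    qed
    then show ?thesis using \<delta>(1) by blast
  qed
  have end_touch: "\<exists>t. (c, t) \<in> A i \<and> knaster_line i (c, t) \<in> S"
    if c: "c \<in> cantor_set" and S: "open S"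
      and z: "(arc_start i c, arc_start i c) \<in> S \<or> (arc_end i c, arc_end i c) \<in> S" for i c S
    using z
  proof
    assume "(arc_start i c, arc_start i c) \<in> S"
    then have "eventually (\<lambda>r. knaster_line i (c, r) \<in> S) at_bot"
      using topological_tendstoD[OF knaster_line_tendsto(1) S] by blast
    then obtain R where "\<And>r. r \<le> R \<Longrightarrow> knaster_line i (c, r) \<in> S"
      by (auto simp: eventually_at_bot_linorder)
    moreover obtain t where "t < R" "(c, t) \<in> A i" using exists[OF c, of "R - 1" R i] by auto
    ultimately show ?thesis by (meson less_imp_le)
  next
    assume "(arc_end i c, arc_end i c) \<in> S"
    then have "eventually (\<lambda>r. knaster_line i (c, r) \<in> S) at_top"
      using topological_tendstoD[OF knaster_line_tendsto(2) S] by blast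
    then obtain R where "\<And>r. R \<le> r \<Longrightarrow> knaster_line i (c, r) \<in> S"
      by (auto simp: eventually_at_top_linorder)
    moreover obtain t where "R < t" "(c, t) \<in> A i" using exists[OF c, of R "R + 1" i] by auto
    ultimately show ?thesis by (meson less_imp_le)
  qed
  have ends: "(z, z) \<in> U \<longleftrightarrow> inU i c"
    if c: "c \<in> Z" and z: "z = arc_start i c \<or> z = arc_end i c" for i c z
  proof -
    have cC: "c \<in> cantor_set" and zZ: "z \<in> Z"
      using c z Z(1) by (auto simp: arc_invariant_def)
    show ?thesis
    proof
      assume "(z, z) \<in> U"
      then obtain t where "(c, t) \<in> A i" "knaster_line i (c, t) \<in> U" using end_touch[OF cC U] z by blast
      then show "inU i c" by (rule inUI)
    next
      assume i: "inU i c"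
      show "(z, z) \<in> U"
      proof (rule ccontr)
        assume "(z, z) \<notin> U"
        then have "(z, z) \<in> V" using diag_in[OF zZ] cover by blast
        then obtain t where "(c, t) \<in> A i" "knaster_line i (c, t) \<in> V" using end_touch[OF cC V] z by blast
        then show False using inU_V i by blast
      qed
    qed
  qed
  have ZC: "z \<in> cantor_set" if "z \<in> Z" for z using that Z(1) by (auto simp: arc_invariant_def)
  obtain \<delta> where \<delta>: "0 < \<delta>" "\<And>c. c \<in> cantor_set \<Longrightarrow> \<bar>c\<bar> < \<delta> \<Longrightarrow> inU 0 c"
    using spread[OF U r0(2)] inUI by (metis diff_zero)
  obtain m where m: "(1 / 3) ^ m < \<delta>" using real_arch_pow_inv[OF \<delta>(1), of "1 / 3"] by auto
  have near0: "(c / 3 ^ Suc m, c / 3 ^ Suc m) \<in> U" if "c \<in> Z" for c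
  proof -
    have cm: "c / 3 ^ m \<in> Z" using arc_invariant_scale[OF Z(1) that] .
    have "0 \<le> c / 3 ^ m" "c / 3 ^ m \<le> 1 / 3 ^ m"
      using cantor_set_bounds[OF ZC[OF that]] by (auto intro: divide_right_mono)
    then have "\<bar>c / 3 ^ m\<bar> < \<delta>" using m by (simp add: power_one_over)
    then have "inU 0 (c / 3 ^ m)" using \<delta>(2) ZC[OF cm] by blast
    moreover have "c / 3 ^ Suc m = arc_start 0 (c / 3 ^ m)" by (simp add: arc_0)
    ultimately show ?thesis using ends[OF cm] by metis
  qed
  have diag_U: "(z, z) \<in> U" if "z \<in> Z" for z
  proof (rule arc_invariant_propagates[where P = "\<lambda>z. (z, z) \<in> U" and m = "Suc m", OF Z(1) _ near0 that])
    show "(arc_start i c, arc_start i c) \<in> U \<longleftrightarrow> (arc_end i c, arc_end i c) \<in> U" if "c \<in> Z" for i c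
      using ends[OF that] by blast
  qed
  have "knaster_line i (c, r) \<in> U" if cr: "(c, r) \<in> A i" for i c r
  proof (rule ccontr)
    assume "knaster_line i (c, r) \<notin> U"
    then have "knaster_line i (c, r) \<in> V" using line_in[OF cr] cover by blast
    from spread[OF V this] obtain \<delta> where \<delta>: "0 < \<delta>"
      "\<And>c'. c' \<in> cantor_set \<Longrightarrow> \<bar>c' - c\<bar> < \<delta> \<Longrightarrow> \<exists>t. (c', t) \<in> A i \<and> knaster_line i (c', t) \<in> V"
      by blast
    have "c \<in> cantor_set" using cr A Y_fst by fastforce
    then have "c \<in> closure Z" using dense_arc_invariant[OF Z] by blast
    then obtain z where z: "z \<in> Z" "dist z c < \<delta>" using \<delta>(1) closure_approachable by blast
    then obtain t where t: "(z, t) \<in> A i" "knaster_line i (z, t) \<in> V"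
      using \<delta>(2)[of z] ZC by (auto simp: dist_real_def)
    have "arc_start i z \<in> Z" using z(1) ZC Z(1) by (auto simp: arc_invariant_def)
    then have "inU i z" using ends[OF z(1), of "arc_start i z" i] diag_U by blast
    then show False using inU_V t by blast
  qed
  then show ?thesis using diag_U by (auto simp: knaster_part_def)
qed

text \<open>
  Whichever open set contains the points of the arc \<open>c = 0\<close> of family \<open>0\<close> contains everything.
\<close>

lemma connected_knaster_part:
  assumes Z: "arc_invariant Z" "Z \<noteq> {}"
    and A: "\<And>i. A i \<subseteq> Y_space d a q"
    and bern: "\<And>i F. closed F \<Longrightarrow> uncountable (F \<inter> Y_space d a q) \<Longrightarrow> F \<inter> A i \<noteq> {}"
  shows "connected (knaster_part Z A)"
proof (rule connectedI)
  fix U V :: "(real \<times> real) set"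
  assume U: "open U" and V: "open V" and ne: "U \<inter> knaster_part Z A \<noteq> {}" "V \<inter> knaster_part Z A \<noteq> {}"
    and disj: "U \<inter> V \<inter> knaster_part Z A = {}" and cover: "knaster_part Z A \<subseteq> U \<union> V"
  obtain r0 where r0: "(0, r0) \<in> A 0"
    using bernstein_part_dense_in_fibre[OF bern zero_in_cantor_set, of 0 1] by auto
  then have "knaster_line 0 (0, r0) \<in> knaster_part Z A"
    unfolding knaster_part_def by blast
  then have "knaster_line 0 (0, r0) \<in> U \<union> V"
    using cover by blast
  then show False
  proof
    assume "knaster_line 0 (0, r0) \<in> U"
    then have "knaster_part Z A \<subseteq> U"
      using knaster_part_one_sided[OF Z A bern U V cover disj r0] by blast
    then show False using disj ne by blast
  next
    assume "knaster_line 0 (0, r0) \<in> V"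
    moreover have cover': "knaster_part Z A \<subseteq> V \<union> U" and disj': "V \<inter> U \<inter> knaster_part Z A = {}"
      using cover disj by auto
    ultimately have "knaster_part Z A \<subseteq> V"
      using knaster_part_one_sided[OF Z A bern V U cover' disj' r0] by blast
    then show False using disj ne by blast
  qed
qed

text \<open>
  One set \<open>T\<close> in the plane serves all charts at once, since there are only countably many of them
  and each of them is injective on \<open>Y\<close>.
\<close>

lemma knaster_bernstein_set:
  "\<exists>T. \<forall>i F. closed F \<and> uncountable (F \<inter> Y_space d a q) \<longrightarrow>
     knaster_line i ` (F \<inter> Y_space d a q) \<inter> T \<noteq> {} \<and> knaster_line i ` (F \<inter> Y_space d a q) - T \<noteq> {}"
proof -
  let ?I = "(UNIV :: nat set) \<times> {F. closed F \<and> uncountable (F \<inter> Y_space d a q)}"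
  have "{F. closed F \<and> uncountable (F \<inter> Y_space d a q)} \<lesssim> {F :: (real \<times> real) set. closed F}"
    by (intro subset_imp_lepoll) auto
  then have "{F. closed F \<and> uncountable (F \<inter> Y_space d a q)} \<lesssim> (UNIV :: real set)"
    using closed_sets_lepoll_reals lepoll_trans by blast
  then have I: "?I \<lesssim> (UNIV :: real set)"
    using times_lepoll_mono[OF lepoll_refl] times_lepoll_reals(2) lepoll_trans by blast
  have large: "(UNIV :: real set) \<lesssim> knaster_line (fst j) ` (snd j \<inter> Y_space d a q)" if "j \<in> ?I" for j
  proof -
    have "inj_on (knaster_line (fst j)) (snd j \<inter> Y_space d a q)"
      using inj_on_knaster_line by (rule inj_on_subset) (auto simp: Y_space_eq)
    moreover have "(UNIV :: real set) \<lesssim> snd j \<inter> Y_space d a q"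
      using that by (intro uncountable_gdelta_lepoll gdelta_closed_Int_Y) auto
    ultimately show ?thesis by (simp add: inj_on_image_lepoll_2)
  qed
  have "\<exists>T. \<forall>j\<in>?I. knaster_line (fst j) ` (snd j \<inter> Y_space d a q) \<inter> T \<noteq> {} \<and>
      knaster_line (fst j) ` (snd j \<inter> Y_space d a q) - T \<noteq> {}"
    by (rule bernstein_set[OF I large])
  then show ?thesis by (simp add: Ball_def)
qed

lemma W_not_biconnected: "\<not> biconnected_space (top_of_set (W_set (X3 d a q)))"
proof -
  let ?Y = "Y_space d a q" and ?W = "W_set (X3 d a q)"
  obtain T where T:
    "\<And>i F. closed F \<Longrightarrow> uncountable (F \<inter> ?Y) \<Longrightarrow> knaster_line i ` (F \<inter> ?Y) \<inter> T \<noteq> {}"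
    "\<And>i F. closed F \<Longrightarrow> uncountable (F \<inter> ?Y) \<Longrightarrow> knaster_line i ` (F \<inter> ?Y) - T \<noteq> {}"
    using knaster_bernstein_set by metis
  define M1 where "M1 = knaster_part (cantor_set \<inter> \<rat>) (\<lambda>i. {p \<in> ?Y. knaster_line i p \<in> T})"
  define M2 where "M2 = knaster_part (cantor_set - \<rat>) (\<lambda>i. {p \<in> ?Y. knaster_line i p \<notin> T})"
  have "\<not> cantor_set \<subseteq> \<rat>"
    using uncountable_cantor_set_Int_open[of UNIV 0] zero_in_cantor_set
      countable_subset[OF _ countable_rat, of cantor_set] by auto
  then obtain s where s: "s \<in> cantor_set" "s \<notin> \<rat>" by blast
  have conn1: "connected M1"
    unfolding M1_def
  proof (rule connected_knaster_part[OF arc_invariant_rational])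
    show "cantor_set \<inter> \<rat> \<noteq> {}" using zero_in_cantor_set by auto
    show "F \<inter> {p \<in> ?Y. knaster_line i p \<in> T} \<noteq> {}" if "closed F" "uncountable (F \<inter> ?Y)" for i F
      using T(1)[OF that, of i] by blast
  qed auto
  have conn2: "connected M2"
    unfolding M2_def
  proof (rule connected_knaster_part[OF arc_invariant_irrational])
    show "cantor_set - \<rat> \<noteq> {}" using s by auto
    show "F \<inter> {p \<in> ?Y. knaster_line i p \<notin> T} \<noteq> {}" if "closed F" "uncountable (F \<inter> ?Y)" for i F
      using T(2)[OF that, of i] by blast
  qed auto
  have union: "M1 \<union> M2 = ?W"
  proof -
    have "?W = (\<lambda>x. (x, x)) ` cantor_set \<union> (\<Union>i. knaster_line i ` ?Y)"
      by (simp add: W_set_def knaster_diagonal_def X3_def image_image knaster_line_def)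
    moreover have "(\<lambda>x. (x, x)) ` cantor_set =
        (\<lambda>x. (x, x)) ` (cantor_set \<inter> \<rat>) \<union> (\<lambda>x. (x, x)) ` (cantor_set - \<rat>)" by blast
    moreover have "knaster_line i ` ?Y = knaster_line i ` {p \<in> ?Y. knaster_line i p \<in> T}
        \<union> knaster_line i ` {p \<in> ?Y. knaster_line i p \<notin> T}" for i by blast
    ultimately show ?thesis
      unfolding M1_def M2_def knaster_part_def by (simp only: UN_Un_distrib Un_ac)
  qed
  have disjoint: "M1 \<inter> M2 = {}"
  proof -
    have "knaster_line i p \<noteq> (x, x)" if "p \<in> ?Y" for i p x
      using knaster_line_coordinates(3)[OF Y_fst[OF that], of i "snd p"] by auto
    then show ?thesis unfolding M1_def M2_def knaster_part_def
      by (auto simp: image_iff) metis+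
  qed
  have "(0, 0) \<in> M1" "(1, 1) \<in> M1"
    using zero_in_cantor_set one_in_cantor_set by (auto simp: M1_def knaster_part_def)
  then have two1: "\<exists>x\<in>M1. \<exists>y\<in>M1. x \<noteq> y"
    by (metis Pair_inject zero_neq_one)
  have "(s, s) \<in> M2" "(1 - s, 1 - s) \<in> M2"
    using s arc_invariant_reflect[OF arc_invariant_irrational, of s] by (auto simp: M2_def knaster_part_def)
  moreover have "s \<noteq> 1 - s"
  proof
    assume "s = 1 - s"
    then have "s = 1 / 2" by simp
    moreover have "(1 / 2 :: real) \<in> \<rat>" by simp
    ultimately show False using s(2) by metis
  qed
  ultimately have two2: "\<exists>x\<in>M2. \<exists>y\<in>M2. x \<noteq> y"
    by (metis Pair_inject)
  have "connectedin (top_of_set ?W) M1" "connectedin (top_of_set ?W) M2"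
    using conn1 conn2 union by (auto simp: connectedin_subtopology)
  then show ?thesis
    unfolding biconnected_space_def topspace_euclidean_subtopology
    using union disjoint two1 two2 by blast
qed

end

theorem proposition10:
  fixes d a q :: "nat \<Rightarrow> real"
  assumes "inj d"
    and "range d \<subseteq> cantor_nonendpoints"
    and "cantor_set \<subseteq> closure (range d)"
    and "\<And>n. 0 < a n"
    and "a sums 1"
    and "range q = \<rat>"
  shows "\<not> biconnected_space (top_of_set (W_set (X3 d a q)))"
proof -
  interpret cantor_jumps d a q
    by (rule cantor_jumps.intro[OF assms(1-5)])
  show ?thesis by (rule W_not_biconnected)
qed

end
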